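(* Let $k\ge2$ be a constant. If we can solve #F$k$-XOR with $g$ sets of $k^3b$-length vectors in time $T(n)$, then for any $f:(\{0,1\}^b)^k\to\{0,1\}$ we can solve a #F$k$-$f$ instance with $g$ sets of $b$-length vectors in time $T(n)+\tilde{O}(n)$.
   Context: $g=o(\lg n/\lg\lg n)$, $b=o(\lg n)$. A $(g,b)$-factored vector $v$ is a $g$-tuple of sets $v[i]\subseteq\{0,1\}^b$ ("$g$ sets of $b$-length vectors"). For $f:(\{0,1\}^b)^k\to\{0,1\}$, #F$k$-$f$: given $k$ sets $V_1,\dots,V_k$ of $n$ factored vectors each, output $\sum_{v_1\in V_1,\dots,v_k\in V_k}\prod_{i=1}^g\sum_{w_1\in v_1[i],\dots,w_k\in v_k[i]}f(w_1,\dots,w_k)$. #F$k$-XOR is the case $f(w_1,\dots,w_k)=1$ iff $w_1\oplus\cdots\oplus w_k=\vec 0$ (here with vectors of length $k^3b$ in place of $b$). *)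

theory Defs
  imports Complex_Main "HOL-Library.Landau_Symbols"
begin

text \<open>
  Bit vectors in \<open>{0,1}^b\<close> are Boolean lists of length \<open>b\<close>; a factored vector is a list of sets
  of bit vectors.
\<close>

definition factored_vectors :: "nat \<Rightarrow> nat \<Rightarrow> bool list set list set" where
  "factored_vectors g b = {v. length v = g \<and> (\<forall>S\<in>set v. S \<subseteq> {w. length w = b})}"

text \<open>
  \<^const>\<open>listset\<close> is the Cartesian product of a list of sets, so \<open>vs\<close> ranges over
  \<open>V\<^sub>1 \<times> \<dots> \<times> V\<^sub>k\<close> and \<open>ws\<close> over \<open>v\<^sub>1[i] \<times> \<dots> \<times> v\<^sub>k[i]\<close>; the number \<open>k\<close> is the length of \<open>Vs\<close>.
\<close>

definition factored_count ::
    "nat \<Rightarrow> (bool list list \<Rightarrow> bool) \<Rightarrow> bool list set list set list \<Rightarrow> nat" where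
  "factored_count g f Vs =
     (\<Sum>vs\<in>listset Vs. \<Prod>i<g. \<Sum>ws\<in>listset (map (\<lambda>v. v ! i) vs). of_bool (f ws))"

definition xor_vec :: "bool list \<Rightarrow> bool list \<Rightarrow> bool list" where
  "xor_vec u w = map2 (\<noteq>) u w"

definition xor_zero :: "nat \<Rightarrow> bool list list \<Rightarrow> bool" where
  "xor_zero b ws \<longleftrightarrow> foldr xor_vec ws (replicate b False) = replicate b False"


text \<open>
  The model of computation is the deterministic word RAM, with structured control flow. A state
  consists of registers and of a random-access memory. The parameter \<open>B\<close> of the semantics is the
  number of distinct machine words: all values and addresses that a computation produces must be
  below \<open>B\<close>, and a computation that would exceed this bound has no result (there is no
  wrap-around). Each operation, memory access and test takes one unit of time.
\<close>

datatype operand = Const nat | Reg nat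

datatype binop = Add | Sub | Mul | Div | Mod | And | Or | Xor | Shl | Shr

datatype test = Eq operand operand | Less operand operand

datatype com =
    Skip
  | Op nat binop operand operand
  | Load nat operand
  | Store operand operand
  | Seq com com
  | Cond test com com
  | Loop test com

type_synonym state = "(nat \<Rightarrow> nat) \<times> (nat \<Rightarrow> nat)"

fun opval :: "(nat \<Rightarrow> nat) \<Rightarrow> operand \<Rightarrow> nat" where
  "opval R (Const c) = c"
| "opval R (Reg r) = R r"

fun binop_val :: "binop \<Rightarrow> nat \<Rightarrow> nat \<Rightarrow> nat" where
  "binop_val Add x y = x + y"
| "binop_val Sub x y = x - y"
| "binop_val Mul x y = x * y"
| "binop_val Div x y = x div y"
| "binop_val Mod x y = x mod y"
| "binop_val And x y = Bit_Operations.and x y"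
| "binop_val Or x y = Bit_Operations.or x y"
| "binop_val Xor x y = Bit_Operations.xor x y"
| "binop_val Shl x y = push_bit y x"
| "binop_val Shr x y = drop_bit y x"

fun test_val :: "(nat \<Rightarrow> nat) \<Rightarrow> test \<Rightarrow> bool" where
  "test_val R (Eq x y) \<longleftrightarrow> opval R x = opval R y"
| "test_val R (Less x y) \<longleftrightarrow> opval R x < opval R y"

text \<open>\<open>exec B p s t s'\<close>: started in state \<open>s\<close>, the program \<open>p\<close> halts after \<open>t\<close> steps in \<open>s'\<close>.\<close>

inductive exec :: "nat \<Rightarrow> com \<Rightarrow> state \<Rightarrow> nat \<Rightarrow> state \<Rightarrow> bool" for B :: nat where
  Skip: "exec B Skip s 1 s"
| Op: "v = binop_val bop (opval R x) (opval R y) \<Longrightarrow> v < B \<Longrightarrow>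
    exec B (Op r bop x y) (R, M) 1 (R(r := v), M)"
| Load: "opval R x < B \<Longrightarrow>
    exec B (Load r x) (R, M) 1 (R(r := M (opval R x)), M)"
| Store: "opval R x < B \<Longrightarrow> opval R y < B \<Longrightarrow>
    exec B (Store x y) (R, M) 1 (R, M(opval R x := opval R y))"
| Seq: "exec B p s t s' \<Longrightarrow> exec B q s' t' s'' \<Longrightarrow> exec B (Seq p q) s (t + t') s''"
| CondTrue: "test_val (fst s) e \<Longrightarrow> exec B p s t s' \<Longrightarrow> exec B (Cond e p q) s (1 + t) s'"
| CondFalse: "\<not> test_val (fst s) e \<Longrightarrow> exec B q s t s' \<Longrightarrow> exec B (Cond e p q) s (1 + t) s'"
| LoopFalse: "\<not> test_val (fst s) e \<Longrightarrow> exec B (Loop e p) s 1 s"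
| LoopTrue: "test_val (fst s) e \<Longrightarrow> exec B p s t s' \<Longrightarrow> exec B (Loop e p) s' t' s'' \<Longrightarrow>
    exec B (Loop e p) s (1 + t + t') s''"

definition initial_state :: "nat list \<Rightarrow> state" where
  "initial_state inp = ((\<lambda>_. 0), (\<lambda>i. if i < length inp then inp ! i else 0))"

text \<open>
  The answers may exceed a machine word, so they are written in binary to the memory, least
  significant bit first, with the number of bits in register 0.
\<close>

definition outputs :: "state \<Rightarrow> nat \<Rightarrow> bool" where
  "outputs s ans \<longleftrightarrow> (\<forall>i<fst s 0. snd s i < 2) \<and> ans = (\<Sum>i<fst s 0. snd s i * 2 ^ i)"

text \<open>
  A problem assigns to each size parameter \<open>n\<close> the set of pairs of an encoded input and its answer.
  The bound \<open>(n + 2) ^ c\<close> on the machine words means that words have \<open>O(log n)\<close> bits.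
\<close>

definition solves_in_time ::
    "com \<Rightarrow> (nat \<Rightarrow> (nat list \<times> nat) set) \<Rightarrow> (nat \<Rightarrow> real) \<Rightarrow> bool" where
  "solves_in_time p Prob T \<longleftrightarrow>
     (\<exists>c. \<forall>n. \<forall>(inp, ans)\<in>Prob n.
        length inp \<le> (n + 2) ^ c \<and> (\<forall>x\<in>set inp. x < (n + 2) ^ c) \<and>
        (\<exists>t s. exec ((n + 2) ^ c) p (initial_state inp) t s \<and> real t \<le> T n \<and> outputs s ans))"

definition solvable_in_time :: "(nat \<Rightarrow> (nat list \<times> nat) set) \<Rightarrow> (nat \<Rightarrow> real) \<Rightarrow> bool" where
  "solvable_in_time Prob T \<longleftrightarrow> (\<exists>p. solves_in_time p Prob T)"


text \<open>
  A listing presents \<open>k\<close> sets of \<open>n\<close> factored vectors each: every set, of factored vectors as well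
  as of bit vectors, is enumerated without repetition in an arbitrary order.
\<close>

definition listed_sets :: "bool list list list list list \<Rightarrow> bool list set list set list" where
  "listed_sets L = map (\<lambda>V. set (map (map set) V)) L"

definition listings :: "nat \<Rightarrow> nat \<Rightarrow> nat \<Rightarrow> nat \<Rightarrow> bool list list list list list set" where
  "listings k n g b =
     {L. length L = k \<and>
         (\<forall>V\<in>set L. length V = n \<and> distinct (map (map set) V) \<and>
            (\<forall>v\<in>set V. map set v \<in> factored_vectors g b \<and> (\<forall>S\<in>set v. distinct S)))}"

definition encode_vec :: "bool list \<Rightarrow> nat" where
  "encode_vec w = horner_sum of_bool 2 w"

definition encode_set :: "bool list list \<Rightarrow> nat list" where
  "encode_set S = length S # map encode_vec S"

definition encode_listing :: "bool list list list list list \<Rightarrow> nat list" where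
  "encode_listing L = concat (map encode_set (concat (concat L)))"

text \<open>
  The value of \<open>f\<close> at \<open>(w\<^sub>0, \<dots>, w\<^sub>k\<^sub>-\<^sub>1)\<close> is stored at the index whose binary representation is the
  concatenation of the \<open>w\<^sub>j\<close>, least significant bit first.
\<close>

definition truth_table :: "nat \<Rightarrow> nat \<Rightarrow> (bool list list \<Rightarrow> bool) \<Rightarrow> nat list" where
  "truth_table k b f =
     map (\<lambda>t. of_bool (f (map (\<lambda>j. map (\<lambda>i. bit t (b * j + i)) [0..<b]) [0..<k])))
       [0..<2 ^ (k * b)]"

text \<open>
  The parameters \<open>g\<close> and \<open>b\<close>, and with \<open>b\<close> also the function \<open>f\<close>, depend on \<open>n\<close>. They need not be
  computable from \<open>n\<close>, so an algorithm finds \<open>n\<close>, \<open>g\<close>, \<open>b\<close> and the truth table of \<open>f\<close> (of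
  \<open>2^(k b) = n^o(1)\<close> entries) in its input. No table is supplied for XOR.
\<close>

definition FkXOR :: "nat \<Rightarrow> (nat \<Rightarrow> nat) \<Rightarrow> (nat \<Rightarrow> nat) \<Rightarrow> nat \<Rightarrow> (nat list \<times> nat) set" where
  "FkXOR k g b n =
     {([n, g n, b n] @ encode_listing L,
       factored_count (g n) (xor_zero (b n)) (listed_sets L)) | L.
      L \<in> listings k n (g n) (b n)}"

definition Fkf :: "nat \<Rightarrow> (nat \<Rightarrow> nat) \<Rightarrow> (nat \<Rightarrow> nat) \<Rightarrow> (nat \<Rightarrow> bool list list \<Rightarrow> bool) \<Rightarrow>
    nat \<Rightarrow> (nat list \<times> nat) set" where
  "Fkf k g b f n =
     {([n, g n, b n] @ truth_table k (b n) (f n) @ encode_listing L,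
       factored_count (g n) (f n) (listed_sets L)) | L.
      L \<in> listings k n (g n) (b n)}"


text \<open>
  The soft-O hides subpolynomial factors \<open>n^o(1)\<close>: for \<open>b = o(log n)\<close> an input already consists of
  up to \<open>n * g * 2^b = n^(1 + o(1))\<close> bit vectors, which need not be \<open>n * polylog n\<close>.
\<close>

definition soft_O :: "(nat \<Rightarrow> real) \<Rightarrow> (nat \<Rightarrow> real) set" where
  "soft_O h = {r. \<exists>s. (\<forall>e>0. s \<in> O(\<lambda>n. real n powr e)) \<and> r \<in> O(\<lambda>n. h n * s n)}"

end

theory Submission
  imports Defs
begin

text \<open>
  A tuple \<open>(w\<^sub>0, \<dots>, w\<^sub>k\<^sub>-\<^sub>1)\<close> accepted by \<open>f\<close> is identified with its index \<open>t < 2^(k b)\<close> in the truth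
  table. Player \<open>j\<close> replaces each \<open>w\<close> by one vector for every accepted \<open>t\<close> whose \<open>j\<close>-th component
  is \<open>w\<close>; this vector consists of \<open>k\<close> blocks of \<open>k b\<close> bits and carries \<open>t\<close> in the blocks \<open>j\<close> and
  \<open>j + 1 mod k\<close>. The XOR of one vector per player vanishes iff neighbouring players, hence all
  players, chose the same \<open>t\<close>, so each accepted tuple is counted exactly once.

  Since a vector \<open>w\<close> may occur in no accepted tuple, distinct factored vectors could become equal
  and an instance with fewer than \<open>n\<close> vectors would arise. Player \<open>j\<close> therefore also adds a copy of
  \<open>w\<close> marked by a flag bit that only player \<open>j\<close> uses, which can never cancel. For \<open>b = 0\<close> there is
  no room for flags; then either the instance is left unchanged or the answer is \<open>0\<close>.
\<close>

section \<open>Timed execution of word RAM programs\<close>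

text \<open>The bound \<open>T n\<close> speaks only about instances with the same \<open>n\<close>
  and \<open>g\<close>, and \<open>T\<close> is an arbitrary function. The reduction therefore makes
  at most one call, on an instance with exactly \<open>n\<close> factored vectors per player. The
  called program must also find a genuine initial state, with all registers and all memory behind
  its input equal to 0. For this reason the rewriting erases its traces, and programs are specified
  by exact final states.

  Each block is shared by two players because XOR sees only parities: if all players wrote
  \<open>t\<close> into one common block, cancellation would not force equality for three or more
  players. A cycle of pairwise comparisons does, and it needs only \<open>k\<close> blocks.

  Scanning the whole table for every listed bit vector costs about
  \<open>n * g * 2 ^ b * 2 ^ (k * b)\<close> steps for each of the \<open>k\<close> players. With
  \<open>k\<close> constant and \<open>b\<close> below every multiple of the logarithm, this exceeds
  \<open>n\<close> only by a subpolynomial factor. Likewise words of \<open>k ^ 3 * b\<close> bits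
  stay polynomial in \<open>n\<close>.\<close>

definition wp :: "nat \<Rightarrow> com \<Rightarrow> (nat \<Rightarrow> state \<Rightarrow> bool) \<Rightarrow> state \<Rightarrow> bool" where
  "wp B p Q s \<longleftrightarrow> (\<exists>t s'. exec B p s t s' \<and> Q t s')"


lemma wp_Skip [simp]: "wp B Skip Q s \<longleftrightarrow> Q 1 s"
  unfolding wp_def by (subst exec.simps) simp

lemma wp_Op [simp]: "wp B (Op r bop x y) Q (R, M) \<longleftrightarrow>
    binop_val bop (opval R x) (opval R y) < B \<and>
    Q 1 (R(r := binop_val bop (opval R x) (opval R y)), M)"
  unfolding wp_def by (subst exec.simps) simp

lemma wp_Load [simp]: "wp B (Load r x) Q (R, M) \<longleftrightarrow>
    opval R x < B \<and> Q 1 (R(r := M (opval R x)), M)"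
  unfolding wp_def by (subst exec.simps) simp

lemma wp_Store [simp]: "wp B (Store x y) Q (R, M) \<longleftrightarrow>
    opval R x < B \<and> opval R y < B \<and> Q 1 (R, M(opval R x := opval R y))"
  unfolding wp_def by (subst exec.simps) simp

lemma wp_Seq [simp]: "wp B (Seq p q) Q s \<longleftrightarrow> wp B p (\<lambda>t. wp B q (\<lambda>t'. Q (t + t'))) s"
  unfolding wp_def by (subst exec.simps) (simp, metis)

lemma wp_Cond [simp]: "wp B (Cond e p q) Q s \<longleftrightarrow>
    (if test_val (fst s) e then wp B p (\<lambda>t. Q (1 + t)) s else wp B q (\<lambda>t. Q (1 + t)) s)"
  unfolding wp_def by (subst exec.simps) (cases "test_val (fst s) e"; simp; metis)

lemma wp_mono:
  assumes "wp B p Q s" and "\<And>t s'. Q t s' \<Longrightarrow> Q' t s'"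
  shows "wp B p Q' s"
  using assms unfolding wp_def by blast

text \<open>\<open>wp\<close> serves straight-line code, which the simplifier executes symbolically.
  \<open>runs\<close> serves composition: one upper bound on the time and one exact final state, so
  that loops can be treated by induction on the remaining rounds.\<close>

definition runs :: "nat \<Rightarrow> com \<Rightarrow> state \<Rightarrow> nat \<Rightarrow> state \<Rightarrow> bool" where
  "runs B p s a s' \<longleftrightarrow> wp B p (\<lambda>t s''. t \<le> a \<and> s'' = s') s"

lemma runs_iff_exec: "runs B p s a s' \<longleftrightarrow> (\<exists>t\<le>a. exec B p s t s')"
  unfolding runs_def wp_def by blast

lemma runs_le: "runs B p s a s' \<Longrightarrow> a \<le> a' \<Longrightarrow> runs B p s a' s'"
  unfolding runs_def by (auto elim: wp_mono)

lemma runs_Seq: "runs B p s a s1 \<Longrightarrow> runs B q s1 c s2 \<Longrightarrow> runs B (Seq p q) s (a + c) s2"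
  unfolding runs_iff_exec by (meson add_mono exec.Seq)

lemma runs_LoopFalse: "\<not> test_val (fst s) e \<Longrightarrow> runs B (Loop e p) s 1 s"
  unfolding runs_iff_exec by (blast intro: exec.LoopFalse)

lemma runs_LoopTrue:
  assumes "test_val (fst s) e" "runs B p s a s1" "runs B (Loop e p) s1 c s2"
  shows "runs B (Loop e p) s (1 + a + c) s2"
  using assms unfolding runs_iff_exec by (meson add_mono exec.LoopTrue le_refl)

text \<open>The limit occurs in \<open>exec\<close> only as an upper bound. The given solver comes
  with its own exponent in \<open>(n + 2) ^ c\<close>; this lets it run under the larger limit of
  the reduction.\<close>

lemma exec_mono: "exec B p s t s' \<Longrightarrow> B \<le> B' \<Longrightarrow> exec B' p s t s'"
  proof (induction rule: exec.induct)
qed (blast intro: exec.intros less_le_trans)+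

primrec block :: "com list \<Rightarrow> com" where
  "block [] = Skip"
| "block (c # cs) = Seq c (block cs)"

text \<open>The additional step is the \<open>Skip\<close> that closes every
  \<open>block\<close>.\<close>

lemma runs_block3:
  assumes "runs B p s a1 s1" "runs B q s1 a2 s2" "runs B r s2 a3 s3"
  shows "runs B (block [p, q, r]) s (a1 + a2 + a3 + 1) s3"
proof -
  have "runs B Skip s3 1 s3" by (simp add: runs_def)
  from runs_Seq[OF assms(1) runs_Seq[OF assms(2) runs_Seq[OF assms(3) this]]]
  show ?thesis by (simp add: add.assoc)
qed

section \<open>The program that rewrites the instance\<close>

text \<open>\<open>rN\<close> is the number of sets per player, \<open>rK\<close> and
  \<open>rq\<close> are \<open>2 ^ (k * b)\<close> and \<open>2 ^ b\<close>, \<open>rsrc\<close> and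
  \<open>rout\<close> are the read and write pointers. \<open>rj\<close> is the player,
  \<open>rs\<close> and \<open>rl\<close> count the remaining sets and elements, \<open>rh\<close>
  is the address of the length cell of the set being written, \<open>rw\<close> the current element,
  \<open>rt\<close> the table index, \<open>rx\<close> scratch. \<open>rd\<close>, \<open>rF\<close>
  and \<open>rD\<close> hold \<open>2 ^ (b * j)\<close>, \<open>factor j\<close> and
  \<open>flag j\<close>. Register 0 is never touched, since the solver must find it cleared.\<close>

abbreviation (input) rN :: nat where "rN \<equiv> 1"
abbreviation (input) rK :: nat where "rK \<equiv> 2"
abbreviation (input) rq :: nat where "rq \<equiv> 3"
abbreviation (input) rsrc :: nat where "rsrc \<equiv> 4"
abbreviation (input) rout :: nat where "rout \<equiv> 5"
abbreviation (input) rj :: nat where "rj \<equiv> 6"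
abbreviation (input) rs :: nat where "rs \<equiv> 7"
abbreviation (input) rl :: nat where "rl \<equiv> 8"
abbreviation (input) rh :: nat where "rh \<equiv> 9"
abbreviation (input) rw :: nat where "rw \<equiv> 10"
abbreviation (input) rt :: nat where "rt \<equiv> 11"
abbreviation (input) rx :: nat where "rx \<equiv> 12"
abbreviation (input) rd :: nat where "rd \<equiv> 13"
abbreviation (input) rF :: nat where "rF \<equiv> 14"
abbreviation (input) rD :: nat where "rD \<equiv> 15"
abbreviation (input) rb :: nat where "rb \<equiv> 16"

abbreviation (input) Clear :: "nat \<Rightarrow> com" where "Clear r \<equiv> Op r And (Const 0) (Const 0)"
abbreviation (input) Inc :: "nat \<Rightarrow> com" where "Inc r \<equiv> Op r Add (Reg r) (Const 1)"
abbreviation (input) Dec :: "nat \<Rightarrow> com" where "Dec r \<equiv> Op r Sub (Reg r) (Const 1)"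

text \<open>The table starts at address 3, behind \<open>n\<close>, \<open>g\<close> and
  \<open>b\<close>. Division by \<open>rd\<close> and reduction modulo \<open>rq\<close> extract the
  component of the current player from the index in \<open>rt\<close>.\<close>

definition tuple_body :: com where
  "tuple_body = block
    [Op rx Add (Reg rt) (Const 3), Load rx (Reg rx),
     Cond (Eq (Reg rx) (Const 1))
       (block [Op rx Div (Reg rt) (Reg rd), Op rx Mod (Reg rx) (Reg rq),
         Cond (Eq (Reg rx) (Reg rw))
           (block [Op rx Mul (Reg rt) (Reg rF), Store (Reg rout) (Reg rx), Inc rout])
           Skip])
       Skip,
     Clear rx, Inc rt]"

text \<open>Comparing \<open>rq\<close> with 1 decides whether \<open>b > 0\<close>; only then is a
  flagged copy emitted.\<close>

definition elem_body :: com where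
  "elem_body = block
    [block [Load rw (Reg rsrc), Inc rsrc,
       Cond (Less (Const 1) (Reg rq))
         (block [Op rx Add (Reg rw) (Reg rD), Store (Reg rout) (Reg rx), Inc rout, Clear rx])
         Skip],
     Loop (Less (Reg rt) (Reg rK)) tuple_body,
     block [Clear rt, Clear rw, Dec rl]]"

text \<open>The size of the new set is known only after all its elements have been emitted, so a
  length cell is skipped and remembered in \<open>rh\<close>. The final difference of addresses
  includes that cell, hence the \<open>Dec\<close>.\<close>

definition set_body :: com where
  "set_body = block
    [block [Load rl (Reg rsrc), Inc rsrc, Op rh Add (Reg rout) (Const 0), Inc rout],
     Loop (Less (Const 0) (Reg rl)) elem_body,
     block [Op rx Sub (Reg rout) (Reg rh), Dec rx, Store (Reg rh) (Reg rx),
       Clear rx, Clear rh, Dec rs]]"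

definition player_body :: "nat \<Rightarrow> com" where
  "player_body k = block
    [block [Op rx Mul (Reg rb) (Reg rj), Op rd Shl (Const 1) (Reg rx),
     Op rx Mul (Reg rx) (Const k), Op rF Shl (Const 1) (Reg rx),
     Op rx Add (Reg rj) (Const 1), Op rx Mod (Reg rx) (Const k),
     Op rx Mul (Reg rb) (Reg rx), Op rx Mul (Reg rx) (Const k),
     Op rx Shl (Const 1) (Reg rx), Op rF Add (Reg rF) (Reg rx),
     Op rx Mul (Reg rb) (Const (k * k)), Op rx Add (Reg rx) (Reg rj),
     Op rD Shl (Const 1) (Reg rx), Clear rx,
     Op rs Add (Reg rN) (Const 0)],
     Loop (Less (Const 0) (Reg rs)) set_body,
     block [Clear rd, Clear rF, Clear rD, Inc rj]]"

definition load_base :: "nat \<Rightarrow> nat \<Rightarrow> com" where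
  "load_base k r = block
    [Op r Add (Reg rq) (Const 1), Op r Mul (Reg r) (Reg rN), Op r Mul (Reg r) (Const k),
     Op r Add (Reg r) (Reg rK), Op r Add (Reg r) (Const 3)]"

definition setup_prog :: "nat \<Rightarrow> com" where
  "setup_prog k = block
    [Load rb (Const 2), Op rx Mul (Const k) (Reg rb), Op rK Shl (Const 1) (Reg rx),
     Op rq Shl (Const 1) (Reg rb), Load rsrc (Const 0), Load rx (Const 1),
     Op rN Mul (Reg rsrc) (Reg rx), load_base k rout,
     Store (Reg rout) (Reg rsrc), Inc rout, Store (Reg rout) (Reg rx), Inc rout,
     Op rx Mul (Const (k ^ 3)) (Reg rb), Store (Reg rout) (Reg rx), Inc rout,
     Op rsrc Add (Reg rK) (Const 3), Clear rx]"

definition copy_body :: com where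
  "copy_body = block
    [Op rw Add (Reg rt) (Reg rx), Load rh (Reg rw), Store (Reg rw) (Const 0),
     Store (Reg rt) (Reg rh), Clear rw, Clear rh, Inc rt]"

definition erase_body :: com where
  "erase_body = block [Store (Reg rt) (Const 0), Inc rt]"

definition finish_prog :: "nat \<Rightarrow> com" where
  "finish_prog k = block
    [Seq (load_base k rx) (Op rout Sub (Reg rout) (Reg rx)),
     Seq (Loop (Less (Reg rt) (Reg rout)) copy_body)
       (Loop (Less (Reg rt) (Reg rx)) erase_body),
     block [Clear rN, Clear rK, Clear rq, Clear rsrc, Clear rout, Clear rj, Clear rt, Clear rx, Clear rb]]"

definition transform_prog :: "nat \<Rightarrow> com" where
  "transform_prog k = block
    [setup_prog k, Loop (Less (Reg rj) (Const k)) (player_body k), finish_prog k]"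

section \<open>The rewriting as a function on lists of numbers\<close>

definition with_length :: "nat list \<Rightarrow> nat list" where
  "with_length S = length S # S"

lemma drop_append_length: "drop m xs = ys @ zs \<Longrightarrow> drop (m + length ys) xs = zs"
  by (metis add.commute append_eq_conv_conj drop_drop)

lemma length_concat_le:
  assumes "\<And>x. x \<in> set xs \<Longrightarrow> length (f x) \<le> c"
  shows "length (concat (map f xs)) \<le> length xs * c"
  using assms by (induction xs) (auto, fastforce intro: add_mono)

text \<open>The machine sees numbers only. \<open>NL ! j\<close> flattens the factored vectors of
  player \<open>j\<close> into \<open>n * g\<close> sets: every set is rewritten separately, so the
  borders between factored vectors need not be tracked.\<close>

locale transformation =
  fixes k n g b :: nat and tab :: "nat list" and NL :: "nat list list list"
  assumes k_ge_2: "k \<ge> 2"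
    and length_tab: "length tab = 2 ^ (k * b)"
    and length_NL: "length NL = k"
    and length_sets: "\<And>Ss. Ss \<in> set NL \<Longrightarrow> length Ss = n * g"
    and length_set: "\<And>Ss S. Ss \<in> set NL \<Longrightarrow> S \<in> set Ss \<Longrightarrow> length S \<le> 2 ^ b"
    and elem_less: "\<And>Ss S x. Ss \<in> set NL \<Longrightarrow> S \<in> set Ss \<Longrightarrow> x \<in> set S \<Longrightarrow> x < 2 ^ b"
begin

text \<open>An upper bound on the input length that the program can compute from \<open>n\<close>,
  \<open>g\<close> and \<open>b\<close>: three parameters, the table, and \<open>k * (n * g)\<close>
  sets of at most \<open>2 ^ b\<close> elements with a length cell each.\<close>

definition base :: nat where "base = (2 ^ b + 1) * (n * g) * k + 2 ^ (k * b) + 3"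

definition inp :: "nat list" where
  "inp = [n, g, b] @ tab @ concat (map with_length (concat NL))"

text \<open>
  The new instance \<open>out\<close> is built from address \<open>base\<close> on, above the input, and moved down at the end.
\<close>

definition mem :: "nat list \<Rightarrow> nat \<Rightarrow> nat" where
  "mem out i = (if i < base then if i < length inp then inp ! i else 0
     else if i - base < length out then out ! (i - base) else 0)"

text \<open>
  Multiplication by \<open>factor j\<close> copies an index below \<open>2^(k b)\<close> into the blocks \<open>j\<close> and \<open>j + 1 mod k\<close>;
  the flag of player \<open>j\<close> lies beyond all \<open>k\<close> blocks.
\<close>

definition factor :: "nat \<Rightarrow> nat" where
  "factor j = 2 ^ (b * j * k) + 2 ^ (b * (Suc j mod k) * k)"

definition flag :: "nat \<Rightarrow> nat" where
  "flag j = 2 ^ (b * (k * k) + j)"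

definition tuples :: "nat \<Rightarrow> nat \<Rightarrow> nat list \<Rightarrow> nat list" where
  "tuples j w ts = map (\<lambda>t. t * factor j)
     (filter (\<lambda>t. tab ! t = 1 \<and> t div 2 ^ (b * j) mod 2 ^ b = w) ts)"

definition emit :: "nat \<Rightarrow> nat \<Rightarrow> nat list" where
  "emit j w = (if b = 0 then [] else [w + flag j]) @ tuples j w [0..<2 ^ (k * b)]"

definition emit_set :: "nat \<Rightarrow> nat list \<Rightarrow> nat list" where
  "emit_set j S = concat (map (emit j) S)"

definition emit_player :: "nat \<Rightarrow> nat list" where
  "emit_player j = concat (map (\<lambda>S. with_length (emit_set j S)) (NL ! j))"

definition result :: "nat list" where
  "result = [n, g, k ^ 3 * b] @ concat (map emit_player [0..<k])"

text \<open>The shape of the state at the loop heads and loop exits while the output grows. Register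
  0 and the scratch register are 0 in it, so each loop body has to clear what it used.\<close>

definition st :: "nat \<Rightarrow> nat \<Rightarrow> nat \<Rightarrow> nat \<Rightarrow> nat \<Rightarrow> nat \<Rightarrow> nat \<Rightarrow> nat \<Rightarrow> nat \<Rightarrow> nat \<Rightarrow> nat list \<Rightarrow> state"
where
  "st src j s l h w t d F D out =
    ((\<lambda>_. 0)(rN := n * g, rK := 2 ^ (k * b), rq := 2 ^ b, rsrc := src, rout := base + length out,
       rj := j, rs := s, rl := l, rh := h, rw := w, rt := t, rd := d, rF := F, rD := D, rb := b),
     mem out)"

lemma mem_append: "(mem out)(base + length out := v) = mem (out @ [v])"
  by (auto simp: mem_def nth_append fun_eq_iff)

lemma mem_header: "(mem (out @ 0 # xs))(base + length out := v) = mem (out @ v # xs)"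
  by (auto simp: mem_def nth_append nth_Cons' fun_eq_iff)

text \<open>Cells above the output are still 0, so a length cell is reserved by moving the write
  pointer alone; \<open>mem_header\<close> describes filling it in later.\<close>

lemma mem_zero: "mem (out @ [0]) = mem out"
  by (auto simp: mem_def nth_append fun_eq_iff)

lemma length_inp: "length inp \<le> base"
proof -
  have "length (concat NL) = k * (n * g)"
  proof -
    have "length (concat Ls) = length Ls * (n * g)" if "set Ls \<subseteq> set NL" for Ls
      using that length_sets by (induction Ls) auto
    then show ?thesis using length_NL by simp
  qed
  moreover have "length (concat (map with_length (concat NL))) \<le> length (concat NL) * (2 ^ b + 1)"
    by (rule length_concat_le) (use length_set in \<open>auto simp: with_length_def\<close>)
  ultimately show ?thesis
    by (simp add: inp_def base_def length_tab algebra_simps)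
qed

lemma mem_tab: "t < 2 ^ (k * b) \<Longrightarrow> mem out (t + 3) = tab ! t \<and> t + 3 < base"
  using length_inp by (auto simp: mem_def inp_def base_def nth_append length_tab)

lemma src_Cons:
  assumes "drop src inp = x # xs"
  shows "mem out src = x" "src < base" "drop (Suc src) inp = xs"
proof -
  have "src < length inp" using assms by (metis drop_all leI list.distinct(1))
  then show "src < base" "mem out src = x" using assms length_inp
    by (auto simp: mem_def) (metis nth_via_drop)
  show "drop (Suc src) inp = xs" using assms by (metis drop_Suc list.sel(3) tl_drop)
qed

text \<open>Each index costs at most 20 steps, loop test included. Indices and table addresses lie
  below \<open>base\<close>, write addresses below the final write pointer, and the products with
  \<open>factor j\<close> below the one for \<open>2 ^ (k * b)\<close>; this explains the
  assumptions on \<open>B\<close>.\<close>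

lemma tuple_loop:
  assumes "t \<le> 2 ^ (k * b)"
    and "base + length (out @ tuples j w [t..<2 ^ (k * b)]) < B" and "2 ^ (k * b) * factor j < B"
  shows "runs B (Loop (Less (Reg rt) (Reg rK)) tuple_body)
    (st src j s l h w t (2 ^ (b * j)) (factor j) D out) (20 * (2 ^ (k * b) - t) + 1)
    (st src j s l h w (2 ^ (k * b)) (2 ^ (b * j)) (factor j) D
              (out @ tuples j w [t..<2 ^ (k * b)]))"
  using assms
proof (induction "2 ^ (k * b) - t" arbitrary: t out)
  case 0
  then have "[t..<2 ^ (k * b)] = []" "t = 2 ^ (k * b)" by auto
  then show ?case
    using runs_LoopFalse[of "st src j s l h w t (2 ^ (b * j)) (factor j) D out"]
    by (simp add: st_def tuples_def)
next
  case (Suc m)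
  then have t: "t < 2 ^ (k * b)" by simp
  define o1 where "o1 = out @ tuples j w [t]"
  have spl: "out @ tuples j w [t..<2 ^ (k * b)] = o1 @ tuples j w [Suc t..<2 ^ (k * b)]"
    unfolding o1_def using t by (simp add: tuples_def upt_conv_Cons)
  have tA: "mem out (t + 3) = tab ! t" "t + 3 < B" using mem_tab[OF t, of out] Suc.prems by auto
  have tB: "x \<le> t \<Longrightarrow> x < B" for x
    using tA(2) by simp
  have dB: "t div d mod m' < B" "t div d < B" for d m'
    by (meson tB div_le_dividend mod_less_eq_dividend le_trans)+
  have FB: "t * factor j < B"
    using t Suc.prems(3) by (meson le_less_trans less_imp_le mult_le_mono1)
  have body: "runs B tuple_body (st src j s l h w t (2 ^ (b * j)) (factor j) D out) 19
      (st src j s l h w (Suc t) (2 ^ (b * j)) (factor j) D o1)"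
    using tA dB FB Suc.prems(2)
    by (auto simp: runs_def tuple_body_def st_def o1_def tuples_def mem_append fun_eq_iff
        upt_conv_Cons t)
  have "runs B (Loop (Less (Reg rt) (Reg rK)) tuple_body)
    (st src j s l h w t (2 ^ (b * j)) (factor j) D out) (1 + 19 + (20 * (2 ^ (k * b) - Suc t) + 1))
    (st src j s l h w (2 ^ (k * b)) (2 ^ (b * j)) (factor j) D
              (o1 @ tuples j w [Suc t..<2 ^ (k * b)]))"
    by (rule runs_LoopTrue[OF _ body Suc.hyps(1)]) (use Suc t spl in \<open>auto simp: st_def\<close>)
  then show ?case unfolding spl by (rule runs_le) (use t in simp)
qed

lemma elem_loop:
  assumes "drop src inp = S @ post" and "base + length (out @ emit_set j S) < B"
    and "2 ^ (k * b) * factor j < B" and "\<And>x. x \<in> set S \<Longrightarrow> x + flag j < B"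
  shows "runs B (Loop (Less (Const 0) (Reg rl)) elem_body)
    (st src j s (length S) h 0 0 (2 ^ (b * j)) (factor j) (flag j) out)
    (length S * (20 * 2 ^ (k * b) + 30) + 1)
    (st (src + length S) j s 0 h 0 0 (2 ^ (b * j)) (factor j) (flag j) (out @ emit_set j S))"
  using assms
proof (induction S arbitrary: src out)
  case Nil
  then show ?case
    using runs_LoopFalse[of "st src j s 0 h 0 0 (2 ^ (b * j)) (factor j) (flag j) out"]
    by (simp add: st_def emit_set_def)
next
  case (Cons w S)
  let ?K = "2 ^ (k * b) :: nat"
  define o1 where "o1 = out @ (if b = 0 then [] else [w + flag j])"
  have len: "emit_set j (w # S) = emit j w @ emit_set j S" by (simp add: emit_set_def)
  have emit: "out @ emit j w = o1 @ tuples j w [0..<?K]"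
    by (simp add: emit_def o1_def)
  have o1B: "base + length (o1 @ tuples j w [0..<?K]) < B"
    using Cons.prems(2) unfolding len emit[symmetric] by simp
  have src: "mem out src = w" "src < base" "drop (Suc src) inp = S @ post"
    using src_Cons[of src w "S @ post"] Cons.prems by auto
  have q: "(1::nat) < 2 ^ b \<longleftrightarrow> b \<noteq> 0" "(Suc 0) < 2 ^ b \<longleftrightarrow> b \<noteq> 0" 
    by (metis One_nat_def one_less_numeral_iff one_less_power power_0 less_irrefl neq0_conv semiring_norm(76))+
  have lB: "length S < B" 
  proof -
    have "length S \<le> length inp" using arg_cong[OF src(3), of length] by simp
    then show ?thesis using length_inp Cons.prems(2) by simp
  qed
  have 1: "runs B (block [Load rw (Reg rsrc), Inc rsrc,
       Cond (Less (Const 1) (Reg rq))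
         (block [Op rx Add (Reg rw) (Reg rD), Store (Reg rout) (Reg rx), Inc rout, Clear rx])
         Skip])
     (st src j s (Suc (length S)) h 0 0 (2 ^ (b * j)) (factor j) (flag j) out) 12
     (st (Suc src) j s (Suc (length S)) h w 0 (2 ^ (b * j)) (factor j) (flag j) o1)"
    using src Cons.prems(2) Cons.prems(4)[of w]
    by (auto simp: runs_def st_def o1_def mem_append fun_eq_iff q len emit_def)
  have 2: "runs B (Loop (Less (Reg rt) (Reg rK)) tuple_body)
     (st (Suc src) j s (Suc (length S)) h w 0 (2 ^ (b * j)) (factor j) (flag j) o1) (20 * ?K + 1)
     (st (Suc src) j s (Suc (length S)) h w ?K (2 ^ (b * j)) (factor j) (flag j) (out @ emit j w))"
    unfolding emit
    by (rule runs_le[OF tuple_loop]) (use Cons.prems o1B in auto)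
  have 3: "runs B (block [Clear rt, Clear rw, Dec rl])
     (st (Suc src) j s (Suc (length S)) h w ?K (2 ^ (b * j)) (factor j) (flag j) (out @ emit j w)) 6
     (st (Suc src) j s (length S) h 0 0 (2 ^ (b * j)) (factor j) (flag j) (out @ emit j w))"
    using Cons.prems(2) lB by (auto simp: runs_def st_def fun_eq_iff)
  have 4: "runs B (Loop (Less (Const 0) (Reg rl)) elem_body)
    (st (Suc src) j s (length S) h 0 0 (2 ^ (b * j)) (factor j) (flag j) (out @ emit j w))
    (length S * (20 * ?K + 30) + 1)
    (st (Suc src + length S) j s 0 h 0 0 (2 ^ (b * j)) (factor j) (flag j)
       ((out @ emit j w) @ emit_set j S))"
    by (rule Cons.IH) (use Cons.prems src len in auto)
  have "runs B (Loop (Less (Const 0) (Reg rl)) elem_body)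
    (st src j s (Suc (length S)) h 0 0 (2 ^ (b * j)) (factor j) (flag j) out)
    (1 + (12 + (20 * ?K + 1) + 6 + 1) + (length S * (20 * ?K + 30) + 1))
    (st (Suc src + length S) j s 0 h 0 0 (2 ^ (b * j)) (factor j) (flag j)
       ((out @ emit j w) @ emit_set j S))"
    by (rule runs_LoopTrue[OF _ runs_block3[OF 1 2 3, folded elem_body_def] 4]) (simp add: st_def)
  from runs_le[OF this, of "length (w # S) * (20 * ?K + 30) + 1"]
  show ?case by (simp add: len)
qed

lemma set_loop:
  assumes "drop src inp = concat (map with_length Ss) @ post"
    and "base + length (out @ concat (map (\<lambda>S. with_length (emit_set j S)) Ss)) < B"
    and "2 ^ (k * b) * factor j < B" and "2 ^ b + flag j < B"
    and "\<And>S. S \<in> set Ss \<Longrightarrow> length S \<le> 2 ^ b" and "length Ss < B"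
    and "\<And>S x. S \<in> set Ss \<Longrightarrow> x \<in> set S \<Longrightarrow> x < 2 ^ b"
  shows "runs B (Loop (Less (Const 0) (Reg rs)) set_body)
    (st src j (length Ss) 0 0 0 0 (2 ^ (b * j)) (factor j) (flag j) out)
    (length Ss * (2 ^ b * (20 * 2 ^ (k * b) + 30) + 30) + 1)
    (st (src + length (concat (map with_length Ss))) j 0 0 0 0 0 (2 ^ (b * j)) (factor j) (flag j)
       (out @ concat (map (\<lambda>S. with_length (emit_set j S)) Ss)))"
  using assms
proof (induction Ss arbitrary: src out)
  case Nil
  then show ?case
    using runs_LoopFalse[of "st src j 0 0 0 0 0 (2 ^ (b * j)) (factor j) (flag j) out"]
    by (simp add: st_def)
next
  case (Cons S Ss)
  let ?K = "2 ^ (k * b) :: nat"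
  let ?e = "emit_set j S"
  let ?h = "base + length out"
  have src: "mem out src = length S" "src < base"
     "drop (Suc src) inp = S @ concat (map with_length Ss) @ post"
    by (rule src_Cons; use Cons.prems(1) in \<open>simp add: with_length_def[of S]\<close>)+
  have elB: "x + flag j < B" if "x \<in> set S" for x
    using Cons.prems(4) Cons.prems(7)[of S x] that by simp
  have 1: "runs B (block [Load rl (Reg rsrc), Inc rsrc, Op rh Add (Reg rout) (Const 0), Inc rout])
     (st src j (Suc (length Ss)) 0 0 0 0 (2 ^ (b * j)) (factor j) (flag j) out) 5
     (st (Suc src) j (Suc (length Ss)) (length S) ?h 0 0 (2 ^ (b * j)) (factor j) (flag j)
        (out @ [0]))"
    using src Cons.prems(2)
    by (auto simp: runs_def st_def mem_zero fun_eq_iff with_length_def)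
  have 2: "runs B (Loop (Less (Const 0) (Reg rl)) elem_body)
     (st (Suc src) j (Suc (length Ss)) (length S) ?h 0 0 (2 ^ (b * j)) (factor j) (flag j)
        (out @ [0]))
     (2 ^ b * (20 * 2 ^ (k * b) + 30) + 1)
     (st (Suc src + length S) j (Suc (length Ss)) 0 ?h 0 0 (2 ^ (b * j)) (factor j) (flag j)
        ((out @ [0]) @ ?e))"
    by (rule runs_le[OF elem_loop])
      (use Cons.prems src elB in \<open>auto simp: with_length_def intro!: mult_le_mono1\<close>)
  have 3: "runs B (block [Op rx Sub (Reg rout) (Reg rh), Dec rx, Store (Reg rh) (Reg rx),
       Clear rx, Clear rh, Dec rs])
     (st (Suc src + length S) j (Suc (length Ss)) 0 ?h 0 0 (2 ^ (b * j)) (factor j) (flag j)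
        ((out @ [0]) @ ?e)) 10
     (st (Suc src + length S) j (length Ss) 0 0 0 0 (2 ^ (b * j)) (factor j) (flag j)
        (out @ with_length ?e))"
    using Cons.prems(2,6)
    by (auto simp: runs_def st_def fun_eq_iff mem_header with_length_def)
  have 4: "runs B (Loop (Less (Const 0) (Reg rs)) set_body)
    (st (Suc src + length S) j (length Ss) 0 0 0 0 (2 ^ (b * j)) (factor j) (flag j)
        (out @ with_length ?e))
    (length Ss * (2 ^ b * (20 * 2 ^ (k * b) + 30) + 30) + 1)
    (st (Suc src + length S + length (concat (map with_length Ss))) j 0 0 0 0 0 (2 ^ (b * j)) (factor j)
       (flag j) ((out @ with_length ?e) @ concat (map (\<lambda>S. with_length (emit_set j S)) Ss)))"
  proof (rule Cons.IH)
    show "drop (Suc src + length S) inp = concat (map with_length Ss) @ post"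
      using src(3) by (rule drop_append_length)
  qed (use Cons.prems in auto)
  have "runs B (Loop (Less (Const 0) (Reg rs)) set_body)
    (st src j (Suc (length Ss)) 0 0 0 0 (2 ^ (b * j)) (factor j) (flag j) out)
    (1 + (5 + (2 ^ b * (20 * 2 ^ (k * b) + 30) + 1) + 10 + 1) +
      (length Ss * (2 ^ b * (20 * 2 ^ (k * b) + 30) + 30) + 1))
    (st (Suc src + length S + length (concat (map with_length Ss))) j 0 0 0 0 0 (2 ^ (b * j)) (factor j)
       (flag j) ((out @ with_length ?e) @ concat (map (\<lambda>S. with_length (emit_set j S)) Ss)))"
    by (rule runs_LoopTrue[OF _ runs_block3[OF 1 2 3, folded set_body_def] 4]) (simp add: st_def)
  from runs_le[OF this, of "length (S # Ss) * (2 ^ b * (20 * ?K + 30) + 30) + 1"]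
  show ?case by (simp add: with_length_def[of S] add.assoc)
qed

lemma player_loop:
  assumes "j \<le> k" and "drop src inp = concat (map with_length (concat (drop j NL)))"
    and "base + length (out @ concat (map emit_player [j..<k])) < B"
    and "\<And>j. j < k \<Longrightarrow> 2 ^ (k * b) * factor j < B" and "\<And>j. j < k \<Longrightarrow> 2 ^ b + flag j < B"
    and "n * g < B" and "k < B"
  shows "runs B (Loop (Less (Reg rj) (Const k)) (player_body k))
    (st src j 0 0 0 0 0 0 0 0 out)
    ((k - j) * (n * g * (2 ^ b * (20 * 2 ^ (k * b) + 30) + 30) + 40) + 1)
    (st (src + length (concat (map with_length (concat (drop j NL))))) k 0 0 0 0 0 0 0 0
       (out @ concat (map emit_player [j..<k])))"
  using assms(1-3)
proof (induction "k - j" arbitrary: j src out)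
  case 0
  then have "j = k" by simp
  then show ?case
    using runs_LoopFalse[of "st src k 0 0 0 0 0 0 0 0 out"]
    by (simp add: st_def length_NL)
next
  case (Suc m)
  then have j: "j < k" by simp
  let ?s1 = "src + length (concat (map with_length (NL ! j)))"
  let ?T = "n * g * (2 ^ b * (20 * 2 ^ (k * b) + 30) + 30)"
  have drop: "drop j NL = NL ! j # drop (Suc j) NL"
    using j length_NL by (simp add: Cons_nth_drop_Suc)
  have out: "concat (map emit_player [j..<k]) = emit_player j @ concat (map emit_player [Suc j..<k])"
    using j by (simp add: upt_conv_Cons)
  have mem: "NL ! j \<in> set NL" using j length_NL by simp
  \<comment> \<open>An exponent is smaller than its power of two, so the bound on
    \<open>flag j\<close> also covers every shift amount computed for this player.\<close>
  have lim: "x < B" if "x \<le> b * (k * k) + j \<or> x \<le> flag j \<or> x \<le> factor j" for x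
  proof -
    have "b * (k * k) + j < flag j" unfolding flag_def by (rule less_exp)
    moreover have "factor j \<le> 2 ^ (k * b) * factor j" by simp
    ultimately show ?thesis using that assms(4,5)[OF j] by linarith
  qed
  have bnd: "b * i \<le> b * (k * k) + j" "b * i * k \<le> b * (k * k) + j" if "i \<le> k" for i
  proof -
    have "b * i * k \<le> b * (k * k)" using that by simp
    moreover have "b * i \<le> b * i * k" using j by simp
    ultimately show "b * i \<le> b * (k * k) + j" "b * i * k \<le> b * (k * k) + j" by linarith+
  qed
  have modk: "Suc j mod k \<le> k" using j by (simp add: less_imp_le)
  have "(2::nat) ^ (b * j) \<le> flag j"
    unfolding flag_def by (rule power_increasing) (use bnd[of j] j in auto)
  then have lims: "2 ^ (b * j) < B" "2 ^ (b * j * k) < B" "2 ^ (b * (Suc j mod k) * k) < B"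
      "b * j < B" "b * j * k < B" "b * (Suc j mod k) < B" "b * (Suc j mod k) * k < B"
      "b * (k * k) < B" "b * (k * k) + j < B" "factor j < B" "flag j < B"
    using bnd[of j] bnd[of "Suc j mod k"] modk j
    by - (rule lim, simp add: factor_def)+
  have modB: "Suc j mod k < B" "Suc j < B" using modk assms(7) j by linarith+
  have 1: "runs B (block [Op rx Mul (Reg rb) (Reg rj), Op rd Shl (Const 1) (Reg rx),
     Op rx Mul (Reg rx) (Const k), Op rF Shl (Const 1) (Reg rx),
     Op rx Add (Reg rj) (Const 1), Op rx Mod (Reg rx) (Const k),
     Op rx Mul (Reg rb) (Reg rx), Op rx Mul (Reg rx) (Const k),
     Op rx Shl (Const 1) (Reg rx), Op rF Add (Reg rF) (Reg rx),
     Op rx Mul (Reg rb) (Const (k * k)), Op rx Add (Reg rx) (Reg rj),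
     Op rD Shl (Const 1) (Reg rx), Clear rx,
     Op rs Add (Reg rN) (Const 0)])
     (st src j 0 0 0 0 0 0 0 0 out) 20
     (st src j (length (NL ! j)) 0 0 0 0 (2 ^ (b * j)) (factor j) (flag j) out)"
    using lims modB assms(6) length_sets[OF mem]
    by (simp add: runs_def st_def push_bit_eq_mult fun_eq_iff flag_def factor_def)
  have 2: "runs B (Loop (Less (Const 0) (Reg rs)) set_body)
     (st src j (length (NL ! j)) 0 0 0 0 (2 ^ (b * j)) (factor j) (flag j) out) (?T + 1)
     (st ?s1 j 0 0 0 0 0 (2 ^ (b * j)) (factor j) (flag j) (out @ emit_player j))"
    unfolding emit_player_def
    by (rule runs_le[OF set_loop[where post = "concat (map with_length (concat (drop (Suc j) NL)))"]])
      (use Suc.prems drop out assms j length_sets[OF mem] length_set[OF mem] elem_less[OF mem]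
        in \<open>auto simp: emit_player_def\<close>)
  have 3: "runs B (block [Clear rd, Clear rF, Clear rD, Inc rj])
     (st ?s1 j 0 0 0 0 0 (2 ^ (b * j)) (factor j) (flag j) (out @ emit_player j)) 6
     (st ?s1 (Suc j) 0 0 0 0 0 0 0 0 (out @ emit_player j))"
    using lims modB by (simp add: runs_def st_def fun_eq_iff)
  have 4: "runs B (Loop (Less (Reg rj) (Const k)) (player_body k))
    (st ?s1 (Suc j) 0 0 0 0 0 0 0 0 (out @ emit_player j))
    ((k - Suc j) * (?T + 40) + 1)
    (st (?s1 + length (concat (map with_length (concat (drop (Suc j) NL))))) k 0 0 0 0 0 0 0 0
       ((out @ emit_player j) @ concat (map emit_player [Suc j..<k])))"
  proof (rule Suc.hyps(1))
    show "drop ?s1 inp = concat (map with_length (concat (drop (Suc j) NL)))"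
      by (rule drop_append_length) (use Suc.prems(2) drop in simp)
  qed (use Suc j out in auto)
  have "runs B (Loop (Less (Reg rj) (Const k)) (player_body k))
    (st src j 0 0 0 0 0 0 0 0 out) (1 + (20 + (?T + 1) + 6 + 1) + ((k - Suc j) * (?T + 40) + 1))
    (st (?s1 + length (concat (map with_length (concat (drop (Suc j) NL))))) k 0 0 0 0 0 0 0 0
       ((out @ emit_player j) @ concat (map emit_player [Suc j..<k])))"
    by (rule runs_LoopTrue[OF _ runs_block3[OF 1 2 3, folded player_body_def] 4])
      (use j in \<open>simp add: st_def\<close>)
  moreover have "(k - j) * (?T + 40) = (?T + 40) + (k - Suc j) * (?T + 40)"
    using j by (metis Suc_diff_Suc mult_Suc)
  ultimately have "runs B (Loop (Less (Reg rj) (Const k)) (player_body k))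
    (st src j 0 0 0 0 0 0 0 0 out) ((k - j) * (?T + 40) + 1)
    (st (?s1 + length (concat (map with_length (concat (drop (Suc j) NL))))) k 0 0 0 0 0 0 0 0
       ((out @ emit_player j) @ concat (map emit_player [Suc j..<k])))"
    by (elim runs_le) simp
  then show ?case by (simp add: drop out add.assoc)
qed

text \<open>The step count is left in the nested form that \<open>wp_Seq\<close> produces, with the
  closing \<open>Skip\<close> as last summand, so the equation works as a rewrite rule inside longer
  programs.\<close>

lemma wp_load_base:
  assumes "R rN = n * g" "R rK = 2 ^ (k * b)" "R rq = 2 ^ b" "r \<notin> {rN, rK, rq}" "base < B"
  shows "wp B (load_base k r) Q (R, M) \<longleftrightarrow> Q (1 + (1 + (1 + (1 + (1 + 1))))) (R(r := base), M)"
proof -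
  have base: "(n * g + 2 ^ b * (n * g)) * k + 2 ^ (k * b) + 3 = base" by (simp add: base_def)
  have "n * g + 2 ^ b * (n * g) \<le> (n * g + 2 ^ b * (n * g)) * k"
    using k_ge_2 by simp
  moreover have "(2::nat) ^ b \<le> 2 ^ (k * b)"
    using k_ge_2 by (intro power_increasing) simp_all
  ultimately have lim: "Suc (2 ^ b) < B" "n * g + 2 ^ b * (n * g) < B"
    "(n * g + 2 ^ b * (n * g)) * k < B" "(n * g + 2 ^ b * (n * g)) * k + 2 ^ (k * b) < B"
    using base assms(5) by linarith+
  show ?thesis using assms lim by (auto simp: load_base_def base)
qed

lemma sets_less_base: "n * g < base"
proof -
  have "n * g * 1 \<le> n * g * ((2 ^ b + 1) * k)"
    by (rule mult_le_mono2) (use k_ge_2 in simp)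
  also have "\<dots> = (2 ^ b + 1) * (n * g) * k"
    by (simp only: mult.commute mult.left_commute)
  finally show ?thesis unfolding base_def by linarith
qed

lemma setup_prog_correct:
  assumes "base + 3 < B" and "n < B" and "g < B" and "k ^ 3 * b < B"
  shows "runs B (setup_prog k) (initial_state inp) 40
    (st (2 ^ (k * b) + 3) 0 0 0 0 0 0 0 0 0 [n, g, k ^ 3 * b])"
proof -
  have M: "(\<lambda>i. if i < length inp then inp ! i else 0) = mem []"
    using length_inp by (auto simp: mem_def fun_eq_iff)
  have ld: "mem [] 0 = n" "mem [] 1 = g" "mem [] 2 = b"
    by (auto simp: mem_def inp_def base_def)
  have ms: "(mem [])(base := x, Suc base := y, Suc (Suc base) := z) = mem [x, y, z]" for x y z
    using mem_append[of "[]" x] mem_append[of "[x]" y] mem_append[of "[x, y]" z] by simp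
  have "(2::nat) ^ b \<le> 2 ^ (k * b)"
    using k_ge_2 by (intro power_increasing) simp_all
  then have base: "n * g < base" "2 ^ (k * b) + 3 \<le> base" "2 ^ b < base"
    using sets_less_base unfolding base_def by linarith+
  have "k * b \<le> k ^ 3 * b" using k_ge_2 self_le_power[of k 3] by simp
  then have lim: "2 ^ (k * b) < B" "2 ^ b < B" "n * g < B" "2 ^ (k * b) + 3 < B" "base < B"
    "Suc base < B" "Suc (Suc base) < B" "Suc (Suc (Suc base)) < B" "2 < B" "1 < B" "0 < B" "k * b < B"
    using base assms by linarith+
  have "wp B (setup_prog k) (\<lambda>t s'. t \<le> 40 \<and>
      s' = st (2 ^ (k * b) + 3) 0 0 0 0 0 0 0 0 0 [n, g, k ^ 3 * b]) (\<lambda>_. 0, mem [])"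
    using lim assms(2-4)
    by (simp add: setup_prog_def ld[unfolded One_nat_def] push_bit_eq_mult wp_load_base st_def ms,
      simp add: fun_eq_iff)
  then show ?thesis
    unfolding runs_def initial_state_def M .
qed

text \<open>
  Source and target of the move may overlap. Each cell is read before anything at or above it has
  been written, so moving in increasing order and clearing each source cell at once is correct.
\<close>

definition copying :: "nat list \<Rightarrow> nat \<Rightarrow> nat \<Rightarrow> state" where
  "copying out src i =
    ((\<lambda>_. 0)(rN := n * g, rK := 2 ^ (k * b), rq := 2 ^ b, rsrc := src, rout := length out,
       rj := k, rt := i, rx := base, rb := b),
     \<lambda>a. if a < i then out ! a else if base \<le> a \<and> a < base + i then 0 else mem out a)"

lemma copy_loop:
  assumes "i \<le> length out" and "base + length out < B" and "\<And>x. x \<in> set out \<Longrightarrow> x < B"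
  shows "runs B (Loop (Less (Reg rt) (Reg rout)) copy_body) (copying out src i)
    (10 * (length out - i) + 1) (copying out src (length out))"
  using assms(1)
proof (induction "length out - i" arbitrary: i)
  case 0
  then have "i = length out" by simp
  then show ?case
    using runs_LoopFalse[of "copying out src (length out)"] by (simp add: copying_def)
next
  case (Suc m)
  then have i: "i < length out" by simp
  have base: "0 < base" by (simp add: base_def)
  have ld: "mem out (i + base) = out ! i" using i by (simp add: mem_def)
  have "out ! i < B" using assms(3) i by simp
  then have 1: "runs B copy_body (copying out src i) 8 (copying out src (Suc i))"
    using assms(2) i base
    by (auto simp: runs_def copy_body_def copying_def fun_eq_iff ld)
  have 2: "runs B (Loop (Less (Reg rt) (Reg rout)) copy_body) (copying out src (Suc i))
    (10 * (length out - Suc i) + 1) (copying out src (length out))"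
    by (rule Suc.hyps(1)) (use Suc i in auto)
  have "runs B (Loop (Less (Reg rt) (Reg rout)) copy_body) (copying out src i)
    (1 + 8 + (10 * (length out - Suc i) + 1)) (copying out src (length out))"
    by (rule runs_LoopTrue[OF _ 1 2]) (use i in \<open>simp add: copying_def\<close>)
  then show ?case by (rule runs_le) (use i in simp)
qed

text \<open>When the new instance is shorter than \<open>base\<close>, remains of the old input lie
  between its end and \<open>base\<close>, and the solver would see them. Everything from
  \<open>base\<close> on that is not part of the new instance is already 0.\<close>

definition erasing :: "nat list \<Rightarrow> nat \<Rightarrow> nat \<Rightarrow> state" where
  "erasing out src i =
    ((\<lambda>_. 0)(rN := n * g, rK := 2 ^ (k * b), rq := 2 ^ b, rsrc := src, rout := length out,
       rj := k, rt := i, rx := base, rb := b),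
     \<lambda>a. if a < length out then out ! a else if i \<le> a \<and> a < base then mem out a else 0)"

lemma copying_eq_erasing: "copying out src (length out) = erasing out src (length out)"
  by (auto simp: copying_def erasing_def mem_def fun_eq_iff)

text \<open>The maximum covers a new instance that already reaches \<open>base\<close>: the loop
  ends at once and the index register keeps the larger value.\<close>

lemma erase_loop:
  assumes "length out \<le> i" and "base < B"
  shows "runs B (Loop (Less (Reg rt) (Reg rx)) erase_body) (erasing out src i)
    (5 * (base - i) + 1) (erasing out src (max i base))"
  using assms(1)
proof (induction "base - i" arbitrary: i)
  case 0
  then have "base \<le> i" by simp
  then show ?case
    using runs_LoopFalse[of "erasing out src i"] by (simp add: erasing_def)
next
  case (Suc m)
  then have i: "i < base" by simp
  have 1: "runs B erase_body (erasing out src i) 4 (erasing out src (Suc i))"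
    using assms(2) i Suc.prems
    by (auto simp: runs_def erase_body_def erasing_def fun_eq_iff)
  have 2: "runs B (Loop (Less (Reg rt) (Reg rx)) erase_body) (erasing out src (Suc i))
    (5 * (base - Suc i) + 1) (erasing out src (max (Suc i) base))"
    by (rule Suc.hyps(1)) (use Suc i in auto)
  have "runs B (Loop (Less (Reg rt) (Reg rx)) erase_body) (erasing out src i)
    (1 + 4 + (5 * (base - Suc i) + 1)) (erasing out src (max (Suc i) base))"
    by (rule runs_LoopTrue[OF _ 1 2]) (use i in \<open>simp add: erasing_def\<close>)
  moreover have "max (Suc i) base = max i base" using i by simp
  ultimately have "runs B (Loop (Less (Reg rt) (Reg rx)) erase_body) (erasing out src i)
    (1 + 4 + (5 * (base - Suc i) + 1)) (erasing out src (max i base))" by simp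
  then show ?case by (rule runs_le) (use i in simp)
qed

lemma finish_prog_correct:
  assumes "base + length out < B" and "\<And>x. x \<in> set out \<Longrightarrow> x < B"
  shows "runs B (finish_prog k) (st src k 0 0 0 0 0 0 0 0 out) (10 * length out + 5 * base + 30)
    (initial_state out)"
proof -
  have lim: "base < B" "0 < B" "length out < B"
    using assms(1) by linarith+
  have 1: "runs B (Seq (load_base k rx) (Op rout Sub (Reg rout) (Reg rx)))
     (st src k 0 0 0 0 0 0 0 0 out) 10 (copying out src 0)"
    using lim
    by (simp add: runs_def wp_load_base st_def copying_def fun_eq_iff)
  have 2: "runs B (Seq (Loop (Less (Reg rt) (Reg rout)) copy_body)
       (Loop (Less (Reg rt) (Reg rx)) erase_body))
     (copying out src 0) ((10 * (length out - 0) + 1) + (5 * (base - length out) + 1))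
     (erasing out src (max (length out) base))"
    by (rule runs_Seq[OF copy_loop], use assms in simp_all, unfold copying_eq_erasing)
      (use erase_loop[of out "length out"] lim in simp)
  have 3: "runs B (block [Clear rN, Clear rK, Clear rq, Clear rsrc, Clear rout, Clear rj, Clear rt,
       Clear rx, Clear rb]) (erasing out src (max (length out) base)) 15 (initial_state out)"
    using lim by (auto simp: runs_def erasing_def initial_state_def fun_eq_iff)
  show ?thesis
    unfolding finish_prog_def by (rule runs_le[OF runs_block3[OF 1 2 3]]) simp
qed

section \<open>Size of the new instance and total running time\<close>

lemma length_tuples: "length (tuples j w ts) \<le> length ts"
  by (simp add: tuples_def)

lemma length_result: "length result \<le> k * (n * g * (2 ^ b * (2 ^ (k * b) + 1) + 1)) + 3"
proof -
  have 1: "length (emit j w) \<le> 2 ^ (k * b) + 1" for j w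
    using length_tuples[of j w "[0..<2 ^ (k * b)]"] unfolding emit_def by (cases "b = 0") simp_all
  have 2: "length (emit_set j S) \<le> 2 ^ b * (2 ^ (k * b) + 1)" if "length S \<le> 2 ^ b" for j S
    unfolding emit_set_def using length_concat_le[of S "emit j", OF 1]
    by (rule order_trans) (intro mult_le_mono1 that)
  have 3: "length (emit_player j) \<le> n * g * (2 ^ b * (2 ^ (k * b) + 1) + 1)" if "j < k" for j
  proof -
    have mem: "NL ! j \<in> set NL" using that length_NL by simp
    have "length (with_length (emit_set j S)) \<le> 2 ^ b * (2 ^ (k * b) + 1) + 1" if "S \<in> set (NL ! j)" for S
      using 2[OF length_set[OF mem that]] by (simp add: with_length_def)
    then have "length (emit_player j) \<le> length (NL ! j) * (2 ^ b * (2 ^ (k * b) + 1) + 1)"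
      unfolding emit_player_def by (rule length_concat_le)
    then show ?thesis unfolding length_sets[OF mem] .
  qed
  have "length (concat (map emit_player [0..<k])) \<le> length [0..<k] * (n * g * (2 ^ b * (2 ^ (k * b) + 1) + 1))"
    by (rule length_concat_le) (rule 3, simp)
  then show ?thesis by (simp add: result_def)
qed

text \<open>Moving a cell ends in a \<open>Store\<close>, which requires the stored value itself,
  not only its address, to be a machine word.\<close>

lemma result_less:
  assumes "n < B" "g < B" "k ^ 3 * b < B" "base + length result < B"
    and "\<And>j. j < k \<Longrightarrow> 2 ^ (k * b) * factor j < B" and "\<And>j. j < k \<Longrightarrow> 2 ^ b + flag j < B"
    and "x \<in> set result"
  shows "x < B"
proof -
  consider "x \<in> {n, g, k ^ 3 * b}" |
      j S where "j < k" "S \<in> set (NL ! j)" "x \<in> set (with_length (emit_set j S))"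
    using assms(7) unfolding result_def emit_player_def by fastforce
  then show ?thesis
  proof cases
    case 1
    then show ?thesis using assms by auto
  next
    case (2 j S)
    consider "x = length (emit_set j S)" | w where "w \<in> set S" "x \<in> set (emit j w)"
      using 2(3) unfolding emit_set_def with_length_def by auto
    then show ?thesis
    proof cases
      case 1
      obtain xs ys where "NL ! j = xs @ S # ys" using 2(2) by (meson split_list)
      moreover have "length (emit_player j) \<le> length (concat (map emit_player [0..<k]))"
      proof -
        have "j \<in> set [0..<k]" using 2 by simp
        then obtain us vs where "[0..<k] = us @ j # vs" by (meson split_list)
        then show ?thesis by simp
      qed
      ultimately show ?thesis using 1 assms(4) by (simp add: emit_player_def result_def with_length_def)
    next
      case (2 w)
      have "w < 2 ^ b"
        using elem_less \<open>j < k\<close> \<open>S \<in> set (NL ! j)\<close> \<open>w \<in> set S\<close> length_NL nth_mem by metis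
      moreover have "y < B" if "y \<in> set (tuples j w [0..<2 ^ (k * b)])" for y
      proof -
        obtain t where "t < 2 ^ (k * b)" "y = t * factor j" using \<open>y \<in> _\<close> by (auto simp: tuples_def)
        then show ?thesis using assms(5)[OF \<open>j < k\<close>] by (meson le_less_trans less_imp_le mult_le_mono1)
      qed
      ultimately show ?thesis using 2(2) assms(6)[OF \<open>j < k\<close>] by (auto simp: emit_def split: if_splits)
    qed
  qed
qed

lemma transform_prog_correct:
  assumes "n < B" "g < B" "k ^ 3 * b < B" "base + length result < B" "k < B"
    and "\<And>j. j < k \<Longrightarrow> 2 ^ (k * b) * factor j < B" and "\<And>j. j < k \<Longrightarrow> 2 ^ b + flag j < B"
  shows "runs B (transform_prog k) (initial_state inp)
    (k * (n * g * (2 ^ b * (20 * 2 ^ (k * b) + 30) + 30) + 40) + 10 * length result + 5 * base + 80)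
    (initial_state result)"
proof -
  have len: "length [n, g, k ^ 3 * b] \<le> length result" by (simp add: result_def)
  have 1: "runs B (setup_prog k) (initial_state inp) 40
    (st (2 ^ (k * b) + 3) 0 0 0 0 0 0 0 0 0 [n, g, k ^ 3 * b])"
    by (rule setup_prog_correct) (use assms len in auto)
  have "inp = ([n, g, b] @ tab) @ concat (map with_length (concat NL))" "length ([n, g, b] @ tab) = 2 ^ (k * b) + 3"
    by (simp_all add: inp_def length_tab)
  then have src: "drop (2 ^ (k * b) + 3) inp = concat (map with_length (concat (drop 0 NL)))"
    by (metis append_eq_conv_conj drop0)
  have 2: "runs B (Loop (Less (Reg rj) (Const k)) (player_body k))
    (st (2 ^ (k * b) + 3) 0 0 0 0 0 0 0 0 0 [n, g, k ^ 3 * b])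
    ((k - 0) * (n * g * (2 ^ b * (20 * 2 ^ (k * b) + 30) + 30) + 40) + 1)
    (st (2 ^ (k * b) + 3 + length (concat (map with_length (concat (drop 0 NL))))) k 0 0 0 0 0 0 0 0 result)"
    unfolding result_def
  proof (rule player_loop)
    show "base + length ([n, g, k ^ 3 * b] @ concat (map emit_player [0..<k])) < B"
      using assms(4) unfolding result_def .
    show "n * g < B" using sets_less_base assms(4) by simp
  qed (rule src assms le0 | assumption)+
  have 3: "runs B (finish_prog k)
    (st (2 ^ (k * b) + 3 + length (concat (map with_length (concat (drop 0 NL))))) k 0 0 0 0 0 0 0 0 result)
    (10 * length result + 5 * base + 30) (initial_state result)"
    by (rule finish_prog_correct[OF assms(4) result_less[OF assms(1-4,6,7)]])
  show ?thesis unfolding transform_prog_def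
    by (rule runs_le[OF runs_block3[OF 1 2 3]]) simp
qed

end

section \<open>Bit vectors and tuples\<close>

lemma listset_iff:
  "xs \<in> listset As \<longleftrightarrow> length xs = length As \<and> (\<forall>j<length As. xs ! j \<in> As ! j)"
proof (induction As arbitrary: xs)
  case (Cons A As)
  then show ?case
    by (cases xs) (auto simp: set_Cons_def All_less_Suc2)
qed auto

lemma finite_listset: "(\<And>A. A \<in> set As \<Longrightarrow> finite A) \<Longrightarrow> finite (listset As)"
proof (induction As)
  case (Cons A As)
  have "set_Cons A (listset As) = (\<lambda>(x, xs). x # xs) ` (A \<times> listset As)"
    by (auto simp: set_Cons_def)
  then show ?case using Cons by simp
qed simp

text \<open>The inverse is formed component by component. It serves to reindex the outer sum of
  \<open>factored_count\<close> once the replacement is injective for each player.\<close>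

lemma bij_betw_listset:
  assumes "length As = k" "length Bs = k" and "\<And>j. j < k \<Longrightarrow> bij_betw (\<phi> j) (As ! j) (Bs ! j)"
  shows "bij_betw (\<lambda>xs. map (\<lambda>j. \<phi> j (xs ! j)) [0..<k]) (listset As) (listset Bs)"
proof (rule bij_betw_byWitness[where f' = "\<lambda>ys. map (\<lambda>j. inv_into (As ! j) (\<phi> j) (ys ! j)) [0..<k]"])
  show "(\<lambda>xs. map (\<lambda>j. \<phi> j (xs ! j)) [0..<k]) ` listset As \<subseteq> listset Bs"
    using assms bij_betwE by (fastforce simp: listset_iff)
  show "(\<lambda>ys. map (\<lambda>j. inv_into (As ! j) (\<phi> j) (ys ! j)) [0..<k]) ` listset Bs \<subseteq> listset As"
    using assms bij_betwE[OF bij_betw_inv_into] by (fastforce simp: listset_iff)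
  show "\<forall>xs\<in>listset As.
      map (\<lambda>j. inv_into (As ! j) (\<phi> j) (map (\<lambda>j. \<phi> j (xs ! j)) [0..<k] ! j)) [0..<k] = xs"
    using assms bij_betw_inv_into_left[OF assms(3)] by (auto simp: listset_iff list_eq_iff_nth_eq)
  show "\<forall>ys\<in>listset Bs.
      map (\<lambda>j. \<phi> j (map (\<lambda>j. inv_into (As ! j) (\<phi> j) (ys ! j)) [0..<k] ! j)) [0..<k] = ys"
    using assms bij_betw_inv_into_right[OF assms(3)] by (auto simp: listset_iff list_eq_iff_nth_eq)
qed

lemma foldr_xor_vec:
  assumes "\<And>w. w \<in> set ws \<Longrightarrow> length w = m"
  shows "length (foldr xor_vec ws (replicate m False)) = m \<and>
    (\<forall>i<m. foldr xor_vec ws (replicate m False) ! i \<longleftrightarrow> odd (length (filter (\<lambda>w. w ! i) ws)))"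
  using assms by (induction ws) (auto simp: xor_vec_def)

lemma xor_zero_iff:
  assumes "\<And>w. w \<in> set ws \<Longrightarrow> length w = m"
  shows "xor_zero m ws \<longleftrightarrow> (\<forall>i<m. even (card {j. j < length ws \<and> ws ! j ! i}))"
proof -
  have "xor_zero m ws \<longleftrightarrow> (\<forall>i<m. \<not> foldr xor_vec ws (replicate m False) ! i)"
    unfolding xor_zero_def using foldr_xor_vec[of ws m] assms
    by (auto simp: list_eq_iff_nth_eq)
  then show ?thesis using foldr_xor_vec[of ws m] assms
    by (simp add: length_filter_conv_card)
qed

lemma bit_encode_vec: "bit (encode_vec w) i \<longleftrightarrow> i < length w \<and> w ! i"
  by (simp add: encode_vec_def bit_horner_sum_bit_iff)

lemma encode_vec_inj: "length v = length w \<Longrightarrow> encode_vec v = encode_vec w \<Longrightarrow> v = w"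
  using bit_encode_vec[of v] bit_encode_vec[of w] by (auto simp: list_eq_iff_nth_eq)

lemma encode_vec_less: "encode_vec w < 2 ^ length w"
  unfolding encode_vec_def by (rule horner_sum_of_bool_2_less)

lemma less_exp_iff_bit: "(x::nat) < 2 ^ m \<longleftrightarrow> (\<forall>i\<ge>m. \<not> bit x i)"
proof -
  have "x < 2 ^ m \<longleftrightarrow> take_bit m x = x" by (rule take_bit_nat_eq_self_iff[symmetric])
  also have "\<dots> \<longleftrightarrow> (\<forall>i. bit (take_bit m x) i \<longleftrightarrow> bit x i)"
    by (metis bit_eqI)
  also have "\<dots> \<longleftrightarrow> (\<forall>i\<ge>m. \<not> bit x i)"
    unfolding bit_take_bit_iff by (meson not_less)
  finally show ?thesis .
qed

text \<open>Without common ones there is no carry. This makes the bits of words readable although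
  the program forms them by addition and multiplication.\<close>

lemma bit_disjoint_add:
  assumes "\<And>i. \<not> (bit (x::nat) i \<and> bit y i)"
  shows "bit (x + y) i \<longleftrightarrow> bit x i \<or> bit y i"
proof -
  have "Bit_Operations.and x y = 0"
    by (rule bit_eqI) (use assms in \<open>simp add: bit_and_iff\<close>)
  then show ?thesis by (simp add: disjunctive_add_eq_or bit_or_iff)
qed

definition bits :: "nat \<Rightarrow> nat \<Rightarrow> bool list" where
  "bits m x = map (bit x) [0..<m]"

lemma length_bits [simp]: "length (bits m x) = m"
  by (simp add: bits_def)

lemma nth_bits [simp]: "i < m \<Longrightarrow> bits m x ! i = bit x i"
  by (simp add: bits_def)

lemma encode_bits: "x < 2 ^ m \<Longrightarrow> encode_vec (bits m x) = x"
  by (simp add: encode_vec_def bits_def horner_sum_bit_eq_take_bit take_bit_nat_eq_self_iff)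

definition decode_tuple :: "nat \<Rightarrow> nat \<Rightarrow> nat \<Rightarrow> bool list list" where
  "decode_tuple k b t = map (\<lambda>j. map (\<lambda>i. bit t (b * j + i)) [0..<b]) [0..<k]"

lemma truth_table_nth:
  "t < 2 ^ (k * b) \<Longrightarrow> truth_table k b f ! t = of_bool (f (decode_tuple k b t))"
  by (simp add: truth_table_def decode_tuple_def)

lemma length_decode_tuple [simp]: "length (decode_tuple k b t) = k"
  by (simp add: decode_tuple_def)

lemma length_decode_tuple_nth: "j < k \<Longrightarrow> length (decode_tuple k b t ! j) = b"
  by (simp add: decode_tuple_def)

text \<open>Ties the division and remainder in \<open>tuple_body\<close> to the bit layout of the
  truth table.\<close>

lemma encode_decode_tuple:
  assumes "j < k"
  shows "encode_vec (decode_tuple k b t ! j) = t div 2 ^ (b * j) mod 2 ^ b"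
proof -
  have "encode_vec (decode_tuple k b t ! j) = take_bit b (drop_bit (b * j) t)"
    using assms by (intro bit_eqI)
      (auto simp: bit_encode_vec decode_tuple_def bit_take_bit_iff bit_drop_bit_eq)
  then show ?thesis by (simp add: take_bit_eq_mod drop_bit_eq_div)
qed

lemma index_split:
  fixes i k b :: nat
  assumes "i < k * b"
  obtains j r where "j < k" "r < b" "i = b * j + r"
proof
  have "b > 0" using assms by (cases b) auto
  then show "i div b < k" "i mod b < b" "i = b * (i div b) + i mod b"
    using assms by (auto simp: less_mult_imp_div_less)
qed

lemma bij_betw_decode_tuple:
  "bij_betw (decode_tuple k b) {t. t < 2 ^ (k * b)} {ws. length ws = k \<and> (\<forall>w\<in>set ws. length w = b)}"
proof (rule bij_betw_imageI)
  show "inj_on (decode_tuple k b) {t. t < 2 ^ (k * b)}"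
  proof (rule inj_onI)
    fix s t assume *: "s \<in> {t. t < 2 ^ (k * b)}" "t \<in> {t. t < 2 ^ (k * b)}"
      "decode_tuple k b s = decode_tuple k b t"
    show "s = t"
    proof (rule bit_eqI)
      fix i
      show "bit s i \<longleftrightarrow> bit t i"
      proof (cases "i < k * b")
        case True
        then obtain j r where jr: "j < k" "r < b" "i = b * j + r" by (rule index_split)
        then have "decode_tuple k b s ! j ! r = decode_tuple k b t ! j ! r" using * by simp
        then show ?thesis using jr by (simp add: decode_tuple_def)
      next
        case False
        then show ?thesis using * by (simp add: less_exp_iff_bit)
      qed
    qed
  qed
  show "decode_tuple k b ` {t. t < 2 ^ (k * b)} = {ws. length ws = k \<and> (\<forall>w\<in>set ws. length w = b)}"
  proof (intro equalityI subsetI)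
    fix ws :: "bool list list"
    assume "ws \<in> {ws. length ws = k \<and> (\<forall>w\<in>set ws. length w = b)}"
    then have ws: "length ws = k" "\<And>j. j < k \<Longrightarrow> length (ws ! j) = b" by auto
    define t where "t = encode_vec (map (\<lambda>i. ws ! (i div b) ! (i mod b)) [0..<k * b])"
    have "t < 2 ^ (k * b)"
      unfolding t_def using encode_vec_less[of "map (\<lambda>i. ws ! (i div b) ! (i mod b)) [0..<k * b]"] by simp
    moreover have "decode_tuple k b t = ws"
    proof (rule nth_equalityI)
      fix j assume "j < length (decode_tuple k b t)"
      then have j: "j < k" by simp
      show "decode_tuple k b t ! j = ws ! j"
      proof (rule nth_equalityI)
        fix i assume "i < length (decode_tuple k b t ! j)"
        then have i: "i < b" using j by (simp add: length_decode_tuple_nth)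
        have "b * j + i < b * j + b" using i by simp
        also have "\<dots> = b * Suc j" by simp
        also have "\<dots> \<le> k * b" using j by (metis Suc_leI mult.commute mult_le_mono2)
        finally have "b * j + i < k * b" .
        then show "decode_tuple k b t ! j ! i = ws ! j ! i"
          using i j by (simp add: decode_tuple_def t_def bit_encode_vec)
      qed (use j ws in \<open>simp add: length_decode_tuple_nth\<close>)
    qed (use ws in simp)
    ultimately show "ws \<in> decode_tuple k b ` {t. t < 2 ^ (k * b)}" by blast
  qed (auto simp: decode_tuple_def)
qed

section \<open>Binary expansions of block words and flags\<close>

context transformation
begin

lemma block_end_le:
  assumes "c < k"
  shows "b * c * k + k * b \<le> b * (k * k)"
proof -
  have "b * k * Suc c \<le> b * k * k" using assms by (intro mult_le_mono2) simp
  then show ?thesis by (simp add: algebra_simps)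
qed

text \<open>Uniqueness of quotient and remainder modulo the block length; a remainder below it
  excludes length 0.\<close>

lemma block_unique:
  assumes "b * c * k + r = b * c' * k + r'" "r < k * b" "r' < k * b"
  shows "c = c' \<and> r = r'"
proof -
  have r: "r < b * k" "r' < b * k" using assms(2,3) by (simp_all add: mult.commute)
  then have "b * k \<noteq> 0" by linarith
  have "b * k * c + r = b * k * c' + r'" using assms(1) by (simp add: mult.assoc mult.commute[of k])
  moreover have "(b * k * c + r) div (b * k) = c" "(b * k * c' + r') div (b * k) = c'"
    using div_mult_self4[OF \<open>b * k \<noteq> 0\<close>, of c r] div_mult_self4[OF \<open>b * k \<noteq> 0\<close>, of c' r'] r
    by simp_all
  ultimately have "c = c'" by metis
  then show ?thesis using assms(1) by simp
qed

text \<open>With a single player both copies of an index would land in the same block, and their sum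
  would be a shift by one more bit.\<close>

lemma mod_Suc_neq: "j < k \<Longrightarrow> Suc j mod k \<noteq> j"
  using k_ge_2 by (cases "Suc j = k") auto

text \<open>Multiplication by a sum of two powers of two adds two shifted copies of
  \<open>t\<close>; they lie in different blocks, so they do not interfere.\<close>

lemma bit_factor:
  assumes "t < 2 ^ (k * b)" "j < k"
  shows "bit (t * factor j) i \<longleftrightarrow>
    (\<exists>c r. (c = j \<or> c = Suc j mod k) \<and> r < k * b \<and> bit t r \<and> i = b * c * k + r)"
proof -
  have shift: "bit (t * 2 ^ (b * c * k)) i \<longleftrightarrow> (\<exists>r. r < k * b \<and> bit t r \<and> i = b * c * k + r)" for c i
  proof -
    have "bit (t * 2 ^ (b * c * k)) i \<longleftrightarrow> b * c * k \<le> i \<and> bit t (i - b * c * k)"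
      unfolding push_bit_eq_mult[symmetric] by (rule bit_push_bit_iff')
    also have "\<dots> \<longleftrightarrow> (\<exists>r. bit t r \<and> i = b * c * k + r)"
      by (metis add_diff_cancel_left' le_add1 le_add_diff_inverse)
    finally show ?thesis using assms(1) less_exp_iff_bit by (metis not_less)
  qed
  have "bit (t * 2 ^ (b * j * k) + t * 2 ^ (b * (Suc j mod k) * k)) i \<longleftrightarrow>
      bit (t * 2 ^ (b * j * k)) i \<or> bit (t * 2 ^ (b * (Suc j mod k) * k)) i"
  proof (rule bit_disjoint_add)
    fix i show "\<not> (bit (t * 2 ^ (b * j * k)) i \<and> bit (t * 2 ^ (b * (Suc j mod k) * k)) i)"
      unfolding shift using block_unique mod_Suc_neq[OF assms(2)] by metis
  qed
  then show ?thesis unfolding factor_def distrib_left shift by blast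
qed

lemma bit_factor_block:
  assumes "t < 2 ^ (k * b)" "j < k" "r < k * b"
  shows "bit (t * factor j) (b * c * k + r) \<longleftrightarrow> (c = j \<or> c = Suc j mod k) \<and> bit t r"
  unfolding bit_factor[OF assms(1,2)] using block_unique assms(3) by metis

lemma factor_less:
  assumes "t < 2 ^ (k * b)" "j < k"
  shows "t * factor j < 2 ^ (b * (k * k))"
  unfolding less_exp_iff_bit bit_factor[OF assms]
proof (intro allI impI notI, elim exE conjE)
  fix i c r assume *: "b * (k * k) \<le> i" "c = j \<or> c = Suc j mod k" "r < k * b" "i = b * c * k + r"
  then have "c < k" using assms(2) by auto
  from block_end_le[OF this] * show False by simp
qed

lemma factor_pos: "factor j > 0"
  by (simp add: factor_def)

text \<open>\<open>x\<close> lives below bit \<open>b \<le> b * (k * k)\<close>, so beyond the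
  blocks only the flag is visible, and its position names the player.\<close>

lemma bit_flag:
  assumes "x < 2 ^ b"
  shows "bit (x + flag j) (b * (k * k) + i) \<longleftrightarrow> i = j"
proof -
  have b: "b \<le> b * (k * k)" using k_ge_2 by simp
  have "bit (x + flag j) (b * (k * k) + i) \<longleftrightarrow> bit x (b * (k * k) + i) \<or> bit (flag j) (b * (k * k) + i)"
  proof (rule bit_disjoint_add)
    fix i show "\<not> (bit x i \<and> bit (flag j) i)"
      using assms trans_le_add1[OF b, of j] unfolding less_exp_iff_bit
      by (auto simp: flag_def bit_exp_iff)
  qed
  then show ?thesis
    using assms trans_le_add1[OF b, of i] unfolding less_exp_iff_bit
    by (auto simp: flag_def bit_exp_iff)
qed

lemma flag_ge: "2 ^ (b * (k * k)) \<le> x + flag j"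
proof -
  have "(2::nat) ^ (b * (k * k)) \<le> flag j" unfolding flag_def by (rule power_increasing) auto
  then show ?thesis by simp
qed

text \<open>The origin of the length \<open>k ^ 3 * b\<close>: the blocks take
  \<open>k * k * b\<close> bits and the flags \<open>k\<close> more. For \<open>b > 0\<close> the
  flags need at most another \<open>k * k * b\<close> bits, and \<open>2 \<le> k\<close>
  finishes.\<close>

lemma square_add_le_cube: "b > 0 \<Longrightarrow> b * (k * k) + k \<le> k ^ 3 * b"
proof -
  assume "b > 0"
  then have "k * 1 \<le> k * (k * b)" using k_ge_2 by (intro mult_le_mono2) simp
  then have "b * (k * k) + k \<le> 2 * (k * k * b)" by (simp add: algebra_simps)
  also have "\<dots> \<le> k * (k * k * b)" using k_ge_2 by (rule mult_le_mono1)
  finally show ?thesis by (simp add: power3_eq_cube mult.assoc)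
qed

lemma flag_less:
  assumes "x < 2 ^ b" "j < k" "b > 0"
  shows "x + flag j < 2 ^ (k ^ 3 * b)"
proof -
  have "(2::nat) ^ b \<le> flag j"
    unfolding flag_def using k_ge_2 by (intro power_increasing) (auto simp: trans_le_add1)
  then have "x + flag j < flag j + flag j" using assms(1) by linarith
  also have "\<dots> = 2 ^ (b * (k * k) + Suc j)" by (simp add: flag_def)
  also have "\<dots> \<le> 2 ^ (k ^ 3 * b)"
    using square_add_le_cube assms by (intro power_increasing) auto
  finally show ?thesis .
qed

lemma square_le_cube: "b * (k * k) \<le> k ^ 3 * b"
  by (cases "b = 0", simp, rule order_trans[OF le_add1 square_add_le_cube]) simp

text \<open>Block \<open>Suc j\<close> receives \<open>t j\<close> and \<open>t (Suc j)\<close> and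
  nothing else, so even parity there makes these indices equal; the chain of such equations from
  player 0 upwards suffices. Conversely, if all indices agree, a one in block \<open>c\<close> comes
  from exactly two players, \<open>c\<close> and its cyclic predecessor.\<close>

lemma even_card_factor_iff:
  assumes "\<And>j. j < k \<Longrightarrow> t j < 2 ^ (k * b)"
  shows "(\<forall>i<k ^ 3 * b. even (card {j. j < k \<and> bit (t j * factor j) i})) \<longleftrightarrow> (\<forall>j<k. t j = t 0)"
proof
  assume even: "\<forall>i<k ^ 3 * b. even (card {j. j < k \<and> bit (t j * factor j) i})"
  have step: "t (Suc j) = t j" if "Suc j < k" for j
  proof (rule bit_eqI)
    fix r
    show "bit (t (Suc j)) r \<longleftrightarrow> bit (t j) r"
    proof (cases "r < k * b")
      case True
      have "{i. i < k \<and> bit (t i * factor i) (b * Suc j * k + r)} =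
          {i. i = Suc j \<and> bit (t (Suc j)) r} \<union> {i. i = j \<and> bit (t j) r}"
      proof (intro set_eqI)
        fix i
        have "Suc j = Suc i mod k \<longleftrightarrow> i = j" if "i < k"
          using that \<open>Suc j < k\<close> by (cases "Suc i = k") auto
        then show "i \<in> {i. i < k \<and> bit (t i * factor i) (b * Suc j * k + r)} \<longleftrightarrow>
            i \<in> {i. i = Suc j \<and> bit (t (Suc j)) r} \<union> {i. i = j \<and> bit (t j) r}"
          using that bit_factor_block[OF assms _ True, of i i "Suc j"] by auto
      qed
      moreover have "b * Suc j * k + r < k ^ 3 * b"
        using block_end_le[OF that] True square_le_cube by linarith
      ultimately have "even (card ({i. i = Suc j \<and> bit (t (Suc j)) r} \<union> {i. i = j \<and> bit (t j) r}))"
        using even by metis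
      then show ?thesis by (cases "bit (t (Suc j)) r"; cases "bit (t j) r") auto
    next
      case False
      then show ?thesis using assms[of j] assms[of "Suc j"] that
        by (simp add: less_exp_iff_bit)
    qed
  qed
  show "\<forall>j<k. t j = t 0"
  proof (intro allI impI)
    fix j show "j < k \<Longrightarrow> t j = t 0" by (induction j) (use step in auto)
  qed
next
  assume eq: "\<forall>j<k. t j = t 0"
  have t0: "t 0 < 2 ^ (k * b)" using assms k_ge_2 by simp
  show "\<forall>i<k ^ 3 * b. even (card {j. j < k \<and> bit (t j * factor j) i})"
  proof (intro allI impI)
    fix i
    have "{j. j < k \<and> bit (t j * factor j) i} = {j. j < k \<and> bit (t 0 * factor j) i}"
      by (rule Collect_cong) (metis eq)
    moreover have "even (card {j. j < k \<and> bit (t 0 * factor j) i})"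
    proof (cases "\<exists>c r. c < k \<and> r < k * b \<and> bit (t 0) r \<and> i = b * c * k + r")
      case True
      then obtain c r where cr: "c < k" "r < k * b" "bit (t 0) r" "i = b * c * k + r" by blast
      \<comment> \<open>The cyclic predecessor of \<open>c\<close>, the other player that writes
        into block \<open>c\<close>.\<close>
      define c' where "c' = (if c = 0 then k - 1 else c - 1)"
      have c': "c' \<noteq> c" using k_ge_2 cr by (auto simp: c'_def)
      have "{j. j < k \<and> bit (t 0 * factor j) i} = {c, c'}"
      proof (intro set_eqI)
        fix j
        have "j < k \<and> c = Suc j mod k \<longleftrightarrow> j = c'"
          using cr(1) k_ge_2 by (cases "Suc j = k") (auto simp: c'_def dest: dvd_imp_le)
        then show "j \<in> {j. j < k \<and> bit (t 0 * factor j) i} \<longleftrightarrow> j \<in> {c, c'}"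
          using bit_factor_block[OF t0 _ cr(2), of j c] cr by auto
      qed
      then show ?thesis using c' by simp
    next
      case False
      have "{j. j < k \<and> bit (t 0 * factor j) i} = {}"
      proof -
        have "\<not> bit (t 0 * factor j) i" if "j < k" for j
        proof
          assume "bit (t 0 * factor j) i"
          then obtain c r where cr: "c = j \<or> c = Suc j mod k" "r < k * b" "bit (t 0) r" "i = b * c * k + r"
            unfolding bit_factor[OF t0 \<open>j < k\<close>] by blast
          then have "c < k" using that by auto
          then show False using False cr by blast
        qed
        then show ?thesis by blast
      qed
      then show ?thesis by (metis card.empty even_zero)
    qed
    ultimately show "even (card {j. j < k \<and> bit (t j * factor j) i})" by simp
  qed
qed

end

section \<open>The new instance has the same answer\<close>

lemma finite_vectors: "finite {w :: bool list. length w = b}"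
  using finite_lists_length_eq[of "UNIV :: bool set" b] by simp

lemma card_vectors: "card {w :: bool list. length w = b} = 2 ^ b"
  using card_lists_length_eq[of "UNIV :: bool set" b] by simp

lemma concat_map_concat:
  "concat (map h (concat (concat (map F js)))) = concat (map (\<lambda>j. concat (map h (concat (F j)))) js)"
  by (induction js) simp_all

locale listing =
  fixes k n g b :: nat and f :: "bool list list \<Rightarrow> bool" and L :: "bool list list list list list"
  assumes k_ge: "2 \<le> k" and L: "L \<in> listings k n g b"
begin

lemma length_L: "length L = k"
  using L by (simp add: listings_def)

lemma L_nth:
  assumes "j < k"
  shows "length (L ! j) = n" "distinct (map (map set) (L ! j))"
  using assms L by (auto simp: listings_def)

lemma L_elem:
  assumes "V \<in> set L" "v \<in> set V"
  shows "length v = g" and "\<And>S. S \<in> set v \<Longrightarrow> distinct S"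
    and "\<And>S w. S \<in> set v \<Longrightarrow> w \<in> set S \<Longrightarrow> length w = b"
  using assms L by (auto simp: listings_def factored_vectors_def)

definition encoded_sets :: "nat list list list" where
  "encoded_sets = map (\<lambda>V. map (map encode_vec) (concat V)) L"

sublocale transformation k n g b "truth_table k b f" encoded_sets
proof
  show "length (truth_table k b f) = 2 ^ (k * b)" by (simp add: truth_table_def)
  show "length encoded_sets = k" by (simp add: encoded_sets_def length_L)
  fix Ss assume "Ss \<in> set encoded_sets"
  then obtain V where V: "V \<in> set L" "Ss = map (map encode_vec) (concat V)"
    by (auto simp: encoded_sets_def)
  have "length (concat vs) = length vs * g" if "set vs \<subseteq> set V" for vs
    using that L_elem(1)[OF V(1)] by (induction vs) auto
  moreover have "length V = n" using V(1) L by (simp add: listings_def)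
  ultimately show "length Ss = n * g" using V by simp
  fix S assume "S \<in> set Ss"
  then obtain v S' where S: "v \<in> set V" "S' \<in> set v" "S = map encode_vec S'" using V by auto
  \<comment> \<open>Since a listed set has no repetitions, its length is a cardinality and is
    bounded by the number of bit vectors of length \<open>b\<close>.\<close>
  have "card (set S') \<le> card {w :: bool list. length w = b}"
    using L_elem(3)[OF V(1) S(1,2)] by (intro card_mono finite_vectors) auto
  then show "length S \<le> 2 ^ b"
    using L_elem(2)[OF V(1) S(1,2)] S(3) by (simp add: card_vectors distinct_card)
  fix x assume "x \<in> set S"
  then show "x < 2 ^ b" using S L_elem(3)[OF V(1) S(1,2)] encode_vec_less by auto
qed (rule k_ge)

lemma encode_listing_input: "[n, g, b] @ truth_table k b f @ encode_listing L = inp"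
proof -
  have "encode_set = (\<lambda>S. with_length (map encode_vec S))"
    by (simp add: encode_set_def with_length_def fun_eq_iff)
  moreover have "concat encoded_sets = map (map encode_vec) (concat (concat L))"
    unfolding encoded_sets_def by (induction L) simp_all
  ultimately show ?thesis
    unfolding inp_def by (simp add: encode_listing_def comp_def)
qed

lemma set_emit:
  assumes "j < k"
  shows "y \<in> set (emit j x) \<longleftrightarrow> b \<noteq> 0 \<and> y = x + flag j \<or>
    (\<exists>t<2 ^ (k * b). y = t * factor j \<and> f (decode_tuple k b t) \<and>
       encode_vec (decode_tuple k b t ! j) = x)"
proof -
  have "truth_table k b f ! t = 1 \<longleftrightarrow> f (decode_tuple k b t)" if "t < 2 ^ (k * b)" for t
    using that by (simp add: truth_table_nth)
  then have "y \<in> set (tuples j x [0..<2 ^ (k * b)]) \<longleftrightarrow>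
      (\<exists>t<2 ^ (k * b). y = t * factor j \<and> f (decode_tuple k b t) \<and>
         t div 2 ^ (b * j) mod 2 ^ b = x)"
    unfolding tuples_def set_map set_filter set_upt by auto
  then show ?thesis unfolding encode_decode_tuple[OF assms] emit_def by simp
qed

lemma emit_less:
  assumes "j < k" "x < 2 ^ b" "y \<in> set (emit j x)"
  shows "y < 2 ^ (k ^ 3 * b)"
proof -
  have le: "(2::nat) ^ (b * (k * k)) \<le> 2 ^ (k ^ 3 * b)"
    using square_le_cube by (rule power_increasing) simp
  consider "b \<noteq> 0" "y = x + flag j" | t where "t < 2 ^ (k * b)" "y = t * factor j"
    using assms(3) unfolding set_emit[OF assms(1)] by blast
  then show ?thesis
  proof cases
    case 1
    then show ?thesis using flag_less[OF assms(2,1)] by simp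
  next
    case (2 t)
    then show ?thesis using factor_less[OF 2(1) assms(1)] le by linarith
  qed
qed

text \<open>Legality and answer of an instance concern bit vectors, whereas the program handles
  numbers. \<open>emit_vec\<close>, \<open>new_set\<close> and \<open>new_listing\<close> repeat the
  rewriting for bit vectors, and \<open>encode_listing_output\<close> identifies the encoding with
  the output of the program.\<close>

definition emit_vec :: "nat \<Rightarrow> bool list \<Rightarrow> bool list list" where
  "emit_vec j w = map (bits (k ^ 3 * b)) (emit j (encode_vec w))"

definition new_set :: "nat \<Rightarrow> bool list list \<Rightarrow> bool list list" where
  "new_set j S = concat (map (emit_vec j) S)"

definition new_listing :: "bool list list list list list" where
  "new_listing = map (\<lambda>j. map (map (new_set j)) (L ! j)) [0..<k]"

text \<open>All emitted numbers are below \<open>2 ^ (k ^ 3 * b)\<close>, so cutting them to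
  \<open>k ^ 3 * b\<close> bits loses nothing.\<close>

lemma encode_new_set:
  assumes "j < k" "\<And>w. w \<in> set S \<Longrightarrow> length w = b"
  shows "map encode_vec (new_set j S) = emit_set j (map encode_vec S)"
  using assms(2)
proof (induction S)
  case (Cons w S)
  have "encode_vec w < 2 ^ b" using encode_vec_less[of w] Cons.prems by simp
  then have "map encode_vec (emit_vec j w) = emit j (encode_vec w)"
    using emit_less[OF assms(1)] by (auto simp: emit_vec_def comp_def encode_bits intro!: map_idI)
  then show ?case using Cons by (simp add: new_set_def emit_set_def)
qed (simp add: new_set_def emit_set_def)

lemma encode_listing_output: "[n, g, k ^ 3 * b] @ encode_listing new_listing = result"
proof -
  have "concat (map encode_set (concat (map (map (new_set j)) (L ! j)))) = emit_player j" if "j < k" for j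
  proof -
    have "map encode_set (concat (map (map (new_set j)) (L ! j))) =
        map (\<lambda>S. encode_set (new_set j S)) (concat (L ! j))"
      by (simp add: map_concat comp_def)
    also have "\<dots> = map (\<lambda>S. with_length (emit_set j (map encode_vec S))) (concat (L ! j))"
    proof (rule map_cong[OF refl])
      fix S assume "S \<in> set (concat (L ! j))"
      then obtain v where "v \<in> set (L ! j)" "S \<in> set v" by auto
      then have "\<And>w. w \<in> set S \<Longrightarrow> length w = b" using L_elem(3) that length_L by (metis nth_mem)
      from encode_new_set[OF that this]
      show "encode_set (new_set j S) = with_length (emit_set j (map encode_vec S))"
        unfolding encode_set_def with_length_def by (metis length_map)
    qed
    finally show ?thesis using that length_L unfolding emit_player_def
      by (simp add: encoded_sets_def comp_def)
  qed
  then have "concat (map (\<lambda>j. concat (map encode_set (concat (map (map (new_set j)) (L ! j))))) [0..<k]) =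
      concat (map emit_player [0..<k])"
    by (intro arg_cong[where f = concat] map_cong) auto
  moreover have "encode_listing new_listing =
      concat (map (\<lambda>j. concat (map encode_set (concat (map (map (new_set j)) (L ! j))))) [0..<k])"
    unfolding encode_listing_def new_listing_def by (rule concat_map_concat)
  ultimately show ?thesis by (simp add: result_def)
qed

section \<open>Injectivity of the replacement and legality of the new instance\<close>

definition new_vset :: "nat \<Rightarrow> bool list set \<Rightarrow> bool list set" where
  "new_vset j A = (\<Union>w\<in>A. set (emit_vec j w))"

lemma set_new_set: "set (new_set j S) = new_vset j (set S)"
  by (simp add: new_set_def new_vset_def)

lemma bits_eq_iff: "x < 2 ^ m \<Longrightarrow> y < 2 ^ m \<Longrightarrow> bits m x = bits m y \<longleftrightarrow> x = y"
  by (metis encode_bits)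

lemma in_emit_vec:
  assumes "j < k" "length w = b"
  shows "u \<in> set (emit_vec j w) \<longleftrightarrow>
    (b \<noteq> 0 \<and> u = bits (k ^ 3 * b) (encode_vec w + flag j)) \<or>
    (\<exists>t<2 ^ (k * b). u = bits (k ^ 3 * b) (t * factor j) \<and> f (decode_tuple k b t) \<and>
       decode_tuple k b t ! j = w)"
proof -
  have "encode_vec (decode_tuple k b t ! j) = encode_vec w \<longleftrightarrow> decode_tuple k b t ! j = w" for t
    using encode_vec_inj length_decode_tuple_nth[OF assms(1)] assms(2) by metis
  then show ?thesis
    unfolding emit_vec_def set_map image_iff bex_simps Bex_def set_emit[OF assms(1)] by blast
qed

lemma factor_less_cube:
  assumes "t < 2 ^ (k * b)" "j < k"
  shows "t * factor j < 2 ^ (k ^ 3 * b)"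
  using factor_less[OF assms] power_increasing[OF square_le_cube, of "2::nat"] by linarith

lemma bits_factor_eq_iff:
  assumes "s < 2 ^ (k * b)" "t < 2 ^ (k * b)" "j < k"
  shows "bits (k ^ 3 * b) (s * factor j) = bits (k ^ 3 * b) (t * factor j) \<longleftrightarrow> s = t"
  using bits_eq_iff factor_less_cube assms factor_pos[of j] by auto

text \<open>Block words are below \<open>2 ^ (b * (k * k))\<close>, flagged words are not.\<close>

lemma bits_flag_neq_factor:
  assumes "x < 2 ^ b" "b \<noteq> 0" "t < 2 ^ (k * b)" "j < k"
  shows "bits (k ^ 3 * b) (x + flag j) \<noteq> bits (k ^ 3 * b) (t * factor j)"
  using bits_eq_iff[OF flag_less[OF assms(1,4)] factor_less_cube[OF assms(3,4)]] assms(2)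
    flag_ge[of x j] factor_less[OF assms(3,4)] by simp

lemma bits_flag_eq_iff:
  assumes "length v = b" "length w = b" "b \<noteq> 0" "j < k"
  shows "bits (k ^ 3 * b) (encode_vec v + flag j) = bits (k ^ 3 * b) (encode_vec w + flag j) \<longleftrightarrow> v = w"
  using bits_eq_iff[OF flag_less flag_less, of "encode_vec v" j "encode_vec w" j] assms
    encode_vec_less[of v] encode_vec_less[of w] encode_vec_inj[of v w] by auto

text \<open>An emitted vector determines its source: a flagged word contains the encoding of
  \<open>w\<close>, and a block word determines its index \<open>t\<close> and with it the component
  \<open>j\<close>.\<close>

lemma emit_vec_disjoint:
  assumes "j < k" "length v = b" "length w = b" "v \<noteq> w"
  shows "set (emit_vec j v) \<inter> set (emit_vec j w) = {}"
proof (rule equals0I)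
  fix u assume "u \<in> set (emit_vec j v) \<inter> set (emit_vec j w)"
  then have u: "u \<in> set (emit_vec j v)" "u \<in> set (emit_vec j w)" by auto
  have enc: "encode_vec v < 2 ^ b" "encode_vec w < 2 ^ b"
    using encode_vec_less assms(2,3) by metis+
  show False
    using u(1)[unfolded in_emit_vec[OF assms(1,2)]] u(2)[unfolded in_emit_vec[OF assms(1,3)]]
  proof (elim disjE conjE exE)
    assume "b \<noteq> 0" "u = bits (k ^ 3 * b) (encode_vec v + flag j)" "u = bits (k ^ 3 * b) (encode_vec w + flag j)"
    then show False using bits_flag_eq_iff[OF assms(2,3) _ assms(1)] assms(4) by simp
  next
    fix t assume "b \<noteq> 0" "t < 2 ^ (k * b)" "u = bits (k ^ 3 * b) (encode_vec v + flag j)"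
      "u = bits (k ^ 3 * b) (t * factor j)"
    then show False using bits_flag_neq_factor[OF enc(1) _ _ assms(1)] by metis
  next
    fix t assume "b \<noteq> 0" "t < 2 ^ (k * b)" "u = bits (k ^ 3 * b) (encode_vec w + flag j)"
      "u = bits (k ^ 3 * b) (t * factor j)"
    then show False using bits_flag_neq_factor[OF enc(2) _ _ assms(1)] by metis
  next
    fix s t assume "s < 2 ^ (k * b)" "u = bits (k ^ 3 * b) (s * factor j)" "decode_tuple k b s ! j = v"
      "t < 2 ^ (k * b)" "u = bits (k ^ 3 * b) (t * factor j)" "decode_tuple k b t ! j = w"
    then show False using bits_factor_eq_iff[OF _ _ assms(1), of s t] assms(4) by simp
  qed
qed

lemma distinct_emit_vec:
  assumes "j < k" "length w = b"
  shows "distinct (emit_vec j w)"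
proof -
  let ?x = "encode_vec w"
  have x: "?x < 2 ^ b" using encode_vec_less[of w] assms(2) by simp
  have "distinct (tuples j ?x [0..<2 ^ (k * b)])"
    using factor_pos[of j] by (auto simp: tuples_def distinct_map intro!: inj_onI)
  moreover have "?x + flag j \<notin> set (tuples j ?x [0..<2 ^ (k * b)])"
    using factor_less[OF _ assms(1)] flag_ge[of ?x j] by (fastforce simp: tuples_def)
  ultimately have "distinct (emit j ?x)" unfolding emit_def by simp
  then show ?thesis unfolding emit_vec_def distinct_map
    using emit_less[OF assms(1) x] by (auto intro!: inj_onI simp: bits_eq_iff)
qed

lemma distinct_new_set:
  assumes "j < k" "distinct S" "\<And>w. w \<in> set S \<Longrightarrow> length w = b"
  shows "distinct (new_set j S)"
  using assms(2,3)
proof (induction S)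
  case (Cons w S)
  have "set (emit_vec j w) \<inter> set (new_set j S) = {}"
    using emit_vec_disjoint[OF assms(1)] Cons.prems by (fastforce simp: new_set_def)
  then show ?case using Cons distinct_emit_vec[OF assms(1)] by (simp add: new_set_def)
qed (simp add: new_set_def)

lemma length_emit_vec: "u \<in> set (emit_vec j w) \<Longrightarrow> length u = k ^ 3 * b"
  by (auto simp: emit_vec_def)

text \<open>Whether \<open>w\<close> belongs to \<open>A\<close> can be read off from the presence
  of its flagged copy, which no other vector emits.\<close>

lemma inj_on_new_vset:
  assumes "j < k" "b \<noteq> 0"
  shows "inj_on (new_vset j) {A. A \<subseteq> {w. length w = b}}"
proof -
  have iff: "w \<in> A \<longleftrightarrow> bits (k ^ 3 * b) (encode_vec w + flag j) \<in> new_vset j A"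
    if "A \<subseteq> {w. length w = b}" "length w = b" for A w
  proof
    assume "w \<in> A"
    then show "bits (k ^ 3 * b) (encode_vec w + flag j) \<in> new_vset j A"
      using in_emit_vec[OF assms(1) that(2)] assms(2) by (auto simp: new_vset_def)
  next
    let ?u = "bits (k ^ 3 * b) (encode_vec w + flag j)"
    assume "?u \<in> new_vset j A"
    then obtain v where v: "v \<in> A" "?u \<in> set (emit_vec j v)" by (auto simp: new_vset_def)
    have "?u \<in> set (emit_vec j w)" using in_emit_vec[OF assms(1) that(2)] assms(2) by simp
    then have "v = w" using emit_vec_disjoint[OF assms(1), of v w] v that by auto
    then show "w \<in> A" using v by simp
  qed
  show ?thesis
  proof (intro inj_onI set_eqI)
    fix A A' w
    assume *: "A \<in> {A. A \<subseteq> {w. length w = b}}" "A' \<in> {A. A \<subseteq> {w. length w = b}}"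
      "new_vset j A = new_vset j A'"
    show "w \<in> A \<longleftrightarrow> w \<in> A'"
    proof (cases "length w = b")
      case True
      then show ?thesis using iff[of A w] iff[of A' w] * by simp
    qed (use * in auto)
  qed
qed

lemma inj_on_map_new_vset:
  assumes "j < k" "b \<noteq> 0"
  shows "inj_on (map (new_vset j)) (factored_vectors g b)"
proof (rule inj_onI)
  fix u v assume *: "u \<in> factored_vectors g b" "v \<in> factored_vectors g b"
    "map (new_vset j) u = map (new_vset j) v"
  have "inj_on (new_vset j) (set u \<union> set v)"
    by (rule inj_on_subset[OF inj_on_new_vset[OF assms]]) (use * in \<open>auto simp: factored_vectors_def\<close>)
  then show "u = v" using *(3) by (rule map_inj_on[rotated])
qed

text \<open>\<open>listings\<close> compares factored vectors as lists of sets, so their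
  distinctness is carried over by the injectivity of \<open>map (new_vset j)\<close>. Inside one
  set, distinctness rests on the disjointness of emissions.\<close>

lemma new_listing_in_listings:
  assumes "b \<noteq> 0"
  shows "new_listing \<in> listings k n g (k ^ 3 * b)"
proof -
  have "length (map (map (new_set j)) (L ! j)) = n \<and>
      distinct (map (map set) (map (map (new_set j)) (L ! j))) \<and>
      (\<forall>v\<in>set (map (map (new_set j)) (L ! j)).
        map set v \<in> factored_vectors g (k ^ 3 * b) \<and> (\<forall>S\<in>set v. distinct S))" if j: "j < k" for j
  proof (intro conjI ballI)
    have V: "L ! j \<in> set L" using j length_L by simp
    show "length (map (map (new_set j)) (L ! j)) = n" using L_nth[OF j] by simp
    have "map (map set) (map (map (new_set j)) (L ! j)) =
        map (map (new_vset j)) (map (map set) (L ! j))"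
      by (simp add: comp_def set_new_set)
    moreover have "inj_on (map (new_vset j)) (set (map (map set) (L ! j)))"
      by (rule inj_on_subset[OF inj_on_map_new_vset[OF j assms]])
        (use L V in \<open>auto simp: listings_def\<close>)
    ultimately show "distinct (map (map set) (map (map (new_set j)) (L ! j)))"
      using L_nth(2)[OF j] by (simp only: distinct_map)
    fix v assume "v \<in> set (map (map (new_set j)) (L ! j))"
    then obtain v' where v': "v' \<in> set (L ! j)" "v = map (new_set j) v'" by auto
    show "map set v \<in> factored_vectors g (k ^ 3 * b)"
      using L_elem(1)[OF V v'(1)] v'(2) length_emit_vec
      by (auto simp: factored_vectors_def new_set_def)
    show "distinct S" if "S \<in> set v" for S
      using that v' distinct_new_set[OF j] L_elem(2,3)[OF V v'(1)] by auto
  qed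
  then show ?thesis by (auto simp: listings_def new_listing_def)
qed

text \<open>Both sides count the set \<open>T\<close> of accepted indices with components in the
  given sets: \<open>decode_tuple\<close> maps it onto the accepted tuples, \<open>\<psi>\<close>
  onto the cancelling ones. The main point is that every cancelling choice of vectors arises from a
  single index.\<close>

lemma coordinate_count:
  assumes "b \<noteq> 0" "length As = k" "\<And>j. j < k \<Longrightarrow> As ! j \<subseteq> {w. length w = b}"
  shows "(\<Sum>ws\<in>listset (map (\<lambda>j. new_vset j (As ! j)) [0..<k]). of_bool (xor_zero (k ^ 3 * b) ws)) =
    (\<Sum>ws\<in>listset As. of_bool (f ws) :: nat)"
proof -
  let ?m = "k ^ 3 * b"
  define T where "T = {t. t < 2 ^ (k * b) \<and> f (decode_tuple k b t) \<and>
    (\<forall>j<k. decode_tuple k b t ! j \<in> As ! j)}"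
  define Y where "Y = listset (map (\<lambda>j. new_vset j (As ! j)) [0..<k]) \<inter> {ws. xor_zero ?m ws}"
  define \<psi> where "\<psi> t = map (\<lambda>j. bits ?m (t * factor j)) [0..<k]" for t
  have fin: "finite (As ! j)" if "j < k" for j
    using assms(3)[OF that] finite_vectors finite_subset by blast
  have finA: "finite (listset As)"
    by (rule finite_listset) (use fin assms(2) in \<open>auto simp: in_set_conv_nth\<close>)
  have finB: "finite (listset (map (\<lambda>j. new_vset j (As ! j)) [0..<k]))"
    by (rule finite_listset) (use fin in \<open>auto simp: new_vset_def\<close>)
  have X: "bij_betw (decode_tuple k b) T (listset As \<inter> {ws. f ws})"
  proof (rule bij_betw_subset[OF bij_betw_decode_tuple])
    show "decode_tuple k b ` T = listset As \<inter> {ws. f ws}"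
    proof (intro equalityI subsetI)
      fix ws assume ws: "ws \<in> listset As \<inter> {ws. f ws}"
      then have "ws \<in> {ws. length ws = k \<and> (\<forall>w\<in>set ws. length w = b)}"
        using assms(2,3) by (fastforce simp: listset_iff in_set_conv_nth)
      then obtain t where "t < 2 ^ (k * b)" "ws = decode_tuple k b t"
        using bij_betw_imp_surj_on[OF bij_betw_decode_tuple[of k b]] by blast
      then show "ws \<in> decode_tuple k b ` T"
        using ws assms(2) by (auto simp: T_def listset_iff)
    qed (use assms(2) in \<open>auto simp: T_def listset_iff\<close>)
  qed (auto simp: T_def)
  have parity: "xor_zero ?m (map (\<lambda>j. bits ?m (y j)) [0..<k]) \<longleftrightarrow>
      (\<forall>i<?m. even (card {j. j < k \<and> bit (y j) i}))" for y
    by (subst xor_zero_iff) (auto intro!: all_cong arg_cong[where f = even] arg_cong[where f = card])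
  have Y: "bij_betw \<psi> T Y"
  proof (rule bij_betw_imageI)
    show "inj_on \<psi> T"
    proof (rule inj_onI)
      fix s t assume "s \<in> T" "t \<in> T" "\<psi> s = \<psi> t"
      moreover from this have "\<psi> s ! 0 = \<psi> t ! 0" by simp
      ultimately show "s = t" using bits_factor_eq_iff[of s t 0] k_ge_2 by (simp add: \<psi>_def T_def)
    qed
    show "\<psi> ` T = Y"
    proof (intro equalityI subsetI)
      fix ws assume "ws \<in> \<psi> ` T"
      then obtain t where t: "t \<in> T" "ws = \<psi> t" by blast
      then have "xor_zero ?m ws"
        using even_card_factor_iff[of "\<lambda>_. t"] by (simp add: parity \<psi>_def T_def)
      moreover have "bits ?m (t * factor j) \<in> new_vset j (As ! j)" if "j < k" for j
        using t(1) that in_emit_vec[OF that, of "decode_tuple k b t ! j"]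
        by (auto simp: T_def new_vset_def length_decode_tuple_nth)
      ultimately show "ws \<in> Y" by (simp add: Y_def t(2) \<psi>_def listset_iff)
    next
      fix ws assume "ws \<in> Y"
      then have ws: "length ws = k" "\<And>j. j < k \<Longrightarrow> ws ! j \<in> new_vset j (As ! j)" "xor_zero ?m ws"
        by (auto simp: Y_def listset_iff)
      \<comment> \<open>The number behind the vector of player \<open>j\<close> is either flagged or
        the block word of an accepted index; what is known about that index concerns only its
        component \<open>j\<close>.\<close>
      have "\<exists>y. ws ! j = bits ?m y \<and> ((\<exists>x<2 ^ b. y = x + flag j) \<or>
          (\<exists>t<2 ^ (k * b). y = t * factor j \<and> f (decode_tuple k b t) \<and>
             decode_tuple k b t ! j \<in> As ! j))" if "j < k" for j
      proof -
        obtain w where w: "w \<in> As ! j" "ws ! j \<in> set (emit_vec j w)"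
          using ws(2)[OF \<open>j < k\<close>] by (auto simp: new_vset_def)
        have lw: "length w = b" using w assms(3)[OF \<open>j < k\<close>] by blast
        show ?thesis
          using w(2)[unfolded in_emit_vec[OF \<open>j < k\<close> lw]] w(1) encode_vec_less[of w] lw by blast
      qed
      then obtain y where y: "\<And>j. j < k \<Longrightarrow> ws ! j = bits ?m (y j)"
        "\<And>j. j < k \<Longrightarrow> (\<exists>x<2 ^ b. y j = x + flag j) \<or>
          (\<exists>t<2 ^ (k * b). y j = t * factor j \<and> f (decode_tuple k b t) \<and>
             decode_tuple k b t ! j \<in> As ! j)" by metis
      have wseq: "ws = map (\<lambda>j. bits ?m (y j)) [0..<k]"
        using ws(1) y(1) by (auto simp: list_eq_iff_nth_eq)
      have even: "\<forall>i<?m. even (card {j. j < k \<and> bit (y j) i})"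
        using ws(3) unfolding wseq parity .
      \<comment> \<open>A flagged word of player \<open>j\<close> sets bit
        \<open>b * (k * k) + j\<close>. Block words are too small for it and the other flags sit
        elsewhere, so the count there would be 1, which is odd.\<close>
      have "\<not> (\<exists>x<2 ^ b. y j = x + flag j)" if "j < k" for j
      proof
        assume "\<exists>x<2 ^ b. y j = x + flag j"
        then obtain x where x: "x < 2 ^ b" "y j = x + flag j" by blast
        have "bit (y i) (b * (k * k) + j) \<longleftrightarrow> i = j" if "i < k" for i
          using y(2)[OF that]
        proof
          assume "\<exists>x<2 ^ b. y i = x + flag i"
          then show ?thesis using bit_flag[of _ i j] by auto
        next
          assume "\<exists>t<2 ^ (k * b). y i = t * factor i \<and> f (decode_tuple k b t) \<and>
             decode_tuple k b t ! i \<in> As ! i"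
          then obtain t where t: "t < 2 ^ (k * b)" "y i = t * factor i" by blast
          have "\<not> bit (y i) (b * (k * k) + j)"
            using factor_less[OF t(1) that] unfolding t(2) less_exp_iff_bit by simp
          moreover have "bit (y j) (b * (k * k) + j)" using bit_flag x by simp
          ultimately show ?thesis by auto
        qed
        then have "{i. i < k \<and> bit (y i) (b * (k * k) + j)} = {j}" using that by auto
        moreover have "b * (k * k) + j < ?m" using square_add_le_cube assms(1) that by simp
        ultimately have "even (card {j})" using even by metis
        then show False by simp
      qed
      then obtain t where t: "\<And>j. j < k \<Longrightarrow> t j < 2 ^ (k * b)" "\<And>j. j < k \<Longrightarrow> y j = t j * factor j"
        "\<And>j. j < k \<Longrightarrow> f (decode_tuple k b (t j))" "\<And>j. j < k \<Longrightarrow> decode_tuple k b (t j) ! j \<in> As ! j"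
        using y(2) by metis
      have "{j. j < k \<and> bit (y j) i} = {j. j < k \<and> bit (t j * factor j) i}" for i
        using t(2) by auto
      then have "\<forall>i<?m. even (card {j. j < k \<and> bit (t j * factor j) i})"
        using even by simp
      then have eq: "\<forall>j<k. t j = t 0"
        using even_card_factor_iff[of t, OF t(1)] by blast
      have "0 < k" using k_ge_2 by simp
      then have "t 0 < 2 ^ (k * b)" "f (decode_tuple k b (t 0))" using t by blast+
      \<comment> \<open>Each player guarantees one component of its own index; equality of the
        indices collects these guarantees on \<open>t 0\<close>.\<close>
      moreover have "\<forall>j<k. decode_tuple k b (t 0) ! j \<in> As ! j" using t(4) eq by metis
      ultimately have "t 0 \<in> T" unfolding T_def by blast
      moreover have "bits ?m (y j) = bits ?m (t 0 * factor j)" if "j \<in> set [0..<k]" for j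
        using that t(2)[of j] eq by (metis atLeastLessThan_iff set_upt)
      then have "ws = \<psi> (t 0)" unfolding wseq \<psi>_def by (rule map_cong[OF refl])
      ultimately show "ws \<in> \<psi> ` T" by blast
    qed
  qed
  have "card Y = card (listset As \<inter> {ws. f ws})"
    using bij_betw_same_card[OF X] bij_betw_same_card[OF Y] by simp
  then show ?thesis using finA finB by (simp add: Y_def)
qed

section \<open>From single coordinates to the whole count\<close>

lemma length_listed_sets: "length (listed_sets L) = k"
  by (simp add: listed_sets_def length_L)

lemma listed_sets_nth: "j < k \<Longrightarrow> listed_sets L ! j = set (map (map set) (L ! j))"
  by (simp add: listed_sets_def length_L)

lemma listed_sets_subset: "j < k \<Longrightarrow> listed_sets L ! j \<subseteq> factored_vectors g b"
  using L length_L by (auto simp: listed_sets_nth listings_def)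

lemma listed_sets_new_listing:
  "listed_sets new_listing = map (\<lambda>j. map (new_vset j) ` (listed_sets L ! j)) [0..<k]"
proof -
  have "set (map (map set) (map (map (new_set j)) (L ! j))) =
      map (new_vset j) ` set (map (map set) (L ! j))" for j
    by (simp add: set_new_set image_image comp_def)
  then show ?thesis
    unfolding new_listing_def by (auto simp: listed_sets_def length_L image_image comp_def)
qed

text \<open>Injectivity for each player matches old and new choices of factored vectors one to one,
  and \<open>coordinate_count\<close> equates the factors of matched choices.\<close>

lemma factored_count_new_listing:
  assumes "b \<noteq> 0"
  shows "factored_count g (xor_zero (k ^ 3 * b)) (listed_sets new_listing) =
    factored_count g f (listed_sets L)"
proof -
  let ?h = "\<lambda>vs. map (\<lambda>j. map (new_vset j) (vs ! j)) [0..<k]"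
  have bij: "bij_betw ?h (listset (listed_sets L)) (listset (listed_sets new_listing))"
  proof (rule bij_betw_listset)
    fix j assume j: "j < k"
    have "inj_on (map (new_vset j)) (listed_sets L ! j)"
      using inj_on_subset[OF inj_on_map_new_vset[OF j assms] listed_sets_subset[OF j]] .
    then show "bij_betw (map (new_vset j)) (listed_sets L ! j) (listed_sets new_listing ! j)"
      using j by (simp add: listed_sets_new_listing bij_betw_def)
  qed (simp_all add: length_listed_sets listed_sets_new_listing)
  have coord: "(\<Sum>ws\<in>listset (map (\<lambda>v. v ! i) (?h vs)). of_bool (xor_zero (k ^ 3 * b) ws)) =
      (\<Sum>ws\<in>listset (map (\<lambda>v. v ! i) vs). of_bool (f ws) :: nat)"
    if "vs \<in> listset (listed_sets L)" "i < g" for vs i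
  proof -
    have vs: "length vs = k" "\<And>j. j < k \<Longrightarrow> vs ! j \<in> factored_vectors g b"
      using that(1) listed_sets_subset by (auto simp: listset_iff length_listed_sets)
    have "map (\<lambda>v. v ! i) (?h vs) = map (\<lambda>j. new_vset j (map (\<lambda>v. v ! i) vs ! j)) [0..<k]"
      using vs that(2) by (auto simp: factored_vectors_def)
    moreover have "map (\<lambda>v. v ! i) vs ! j \<subseteq> {w. length w = b}" if "j < k" for j
      using vs(1) vs(2)[OF that] that \<open>i < g\<close> by (auto simp: factored_vectors_def)
    then have "(\<Sum>ws\<in>listset (map (\<lambda>j. new_vset j (map (\<lambda>v. v ! i) vs ! j)) [0..<k]).
        of_bool (xor_zero (k ^ 3 * b) ws)) =
      (\<Sum>ws\<in>listset (map (\<lambda>v. v ! i) vs). of_bool (f ws) :: nat)"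
      by (intro coordinate_count[OF assms]) (simp_all add: vs(1))
    ultimately show ?thesis by (simp only:)
  qed
  show ?thesis
    unfolding factored_count_def sum.reindex_bij_betw[OF bij, symmetric]
    by (rule sum.cong[OF refl], rule prod.cong[OF refl], rule coord) simp_all
qed

section \<open>The case \<open>b = 0\<close>, with the empty vector as the only bit vector\<close>

lemma listset_coordinate_zero:
  assumes "b = 0" "vs \<in> listset (listed_sets L)" "i < g" "ws \<in> listset (map (\<lambda>v. v ! i) vs)"
  shows "ws = decode_tuple k b 0"
proof (rule nth_equalityI)
  have vs: "length vs = k" "\<And>j. j < k \<Longrightarrow> vs ! j \<in> factored_vectors g b"
    using assms(2) listed_sets_subset by (auto simp: listset_iff length_listed_sets)
  then show "length ws = length (decode_tuple k b 0)" using assms(4) by (simp add: listset_iff)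
  then have ws: "length ws = k" by simp
  fix j assume "j < length ws"
  then have j: "j < k" using ws by simp
  have "ws ! j \<in> vs ! j ! i" using assms(4) j vs(1) by (simp add: listset_iff)
  moreover have "vs ! j ! i \<in> set (vs ! j)" "\<forall>S\<in>set (vs ! j). S \<subseteq> {w. length w = b}"
    using vs(2)[OF j] assms(3) by (auto simp: factored_vectors_def)
  ultimately have "length (ws ! j) = 0" using assms(1) by blast
  then show "ws ! j = decode_tuple k b 0 ! j"
    using j assms(1) by (simp add: decode_tuple_def)
qed

text \<open>Every product has a vanishing factor; coordinate 0 exists because
  \<open>g \<noteq> 0\<close>.\<close>

lemma factored_count_zero:
  assumes "b = 0" "g \<noteq> 0" "\<not> f (decode_tuple k b 0)"
  shows "factored_count g f (listed_sets L) = 0"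
proof -
  have "(\<Prod>i<g. \<Sum>ws\<in>listset (map (\<lambda>v. v ! i) vs). of_bool (f ws) :: nat) = 0"
    if "vs \<in> listset (listed_sets L)" for vs
  proof (rule prod_zero)
    show "\<exists>i\<in>{..<g}. (\<Sum>ws\<in>listset (map (\<lambda>v. v ! i) vs). of_bool (f ws) :: nat) = 0"
    proof (intro bexI)
      show "(\<Sum>ws\<in>listset (map (\<lambda>v. v ! 0) vs). of_bool (f ws) :: nat) = 0"
      proof (rule sum.neutral, intro ballI)
        fix ws assume "ws \<in> listset (map (\<lambda>v. v ! 0) vs)"
        then have "ws = decode_tuple k b 0"
          using listset_coordinate_zero[OF assms(1) that, of 0] assms(2) by blast
        then show "of_bool (f ws) = (0 :: nat)" using assms(3) by simp
      qed
    qed (use assms(2) in simp)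
  qed simp
  then show ?thesis unfolding factored_count_def by (rule sum.neutral[OF ballI])
qed

text \<open>The table has a single entry. If it accepts, the value 0 is replaced by
  \<open>0 * factor j = 0\<close> alone, since no flag is emitted; if \<open>g = 0\<close>, there
  are no sets to change.\<close>

lemma new_listing_zero:
  assumes "b = 0" "g = 0 \<or> f (decode_tuple k b 0)"
  shows "new_listing = L"
proof (rule nth_equalityI)
  fix j assume "j < length new_listing"
  then have j: "j < k" by (simp add: new_listing_def)
  then have V: "L ! j \<in> set L" using length_L by simp
  have "map (new_set j) v = v" if v: "v \<in> set (L ! j)" for v
  proof (cases "g = 0")
    case True
    then show ?thesis using L_elem(1)[OF V v] by simp
  next
    case False
    then have f: "f (decode_tuple k b 0)" using assms(2) by simp
    have "truth_table k b f ! 0 = 1" using f by (simp add: truth_table_nth)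
    then have "emit j 0 = [0]" unfolding emit_def tuples_def using assms(1) by simp
    moreover have "encode_vec [] = 0" "bits (k ^ 3 * b) 0 = []"
      using assms(1) by (simp_all add: encode_vec_def bits_def)
    ultimately have "emit_vec j [] = [[]]" unfolding emit_vec_def by simp
    then have "new_set j S = S" if "\<And>w. w \<in> set S \<Longrightarrow> w = []" for S
      using that by (induction S) (auto simp: new_set_def)
    then show ?thesis using L_elem(3)[OF V v] assms(1) by (intro map_idI) auto
  qed
  then show "new_listing ! j = L ! j" using j by (simp add: new_listing_def map_idI)
qed (simp add: new_listing_def length_L)

lemma new_listing_correct:
  assumes "b \<noteq> 0 \<or> g = 0 \<or> f (decode_tuple k b 0)"
  shows "new_listing \<in> listings k n g (k ^ 3 * b) \<and>
    factored_count g (xor_zero (k ^ 3 * b)) (listed_sets new_listing) =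
      factored_count g f (listed_sets L)"
proof (cases "b = 0")
  case False
  then show ?thesis using new_listing_in_listings factored_count_new_listing by simp
next
  case True
  then have new: "new_listing = L" using new_listing_zero assms by simp
  have "factored_count g (xor_zero (k ^ 3 * b)) (listed_sets L) = factored_count g f (listed_sets L)"
    unfolding factored_count_def
  proof (intro sum.cong prod.cong refl)
    fix vs i ws
    assume *: "vs \<in> listset (listed_sets L)" "i \<in> {..<g}" "ws \<in> listset (map (\<lambda>v. v ! i) vs)"
    then have ws: "ws = decode_tuple k b 0" using listset_coordinate_zero[OF True] by simp
    have "\<forall>w\<in>set ws. length w = 0" using True unfolding ws by (auto simp: decode_tuple_def)
    then have "xor_zero (k ^ 3 * b) ws" using True xor_zero_iff[of ws 0] by simp
    \<comment> \<open>The index \<open>i < g\<close> excludes \<open>g = 0\<close>, which leaves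
      acceptance of the tuple of empty vectors.\<close>
    moreover have "f ws" using * assms True ws by auto
    ultimately show "of_bool (xor_zero (k ^ 3 * b) ws) = (of_bool (f ws) :: nat)" by simp
  qed
  then show ?thesis using new L True by simp
qed

end

section \<open>The reduction and its cost\<close>

text \<open>
  The truncated sum \<open>(1 - g) + b + f(0)\<close> vanishes iff \<open>b = 0\<close>, \<open>g > 0\<close> and \<open>f\<close> rejects; the
  empty output then encodes the answer \<open>0\<close>.
\<close>

definition reduction_prog :: "nat \<Rightarrow> com \<Rightarrow> com" where
  "reduction_prog k p = Seq
    (block [Load 1 (Const 1), Op 1 Sub (Const 1) (Reg 1), Load 2 (Const 2), Op 1 Add (Reg 1) (Reg 2),
       Load 2 (Const 3), Op 1 Add (Reg 1) (Reg 2), Clear 2])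
    (Cond (Eq (Reg 1) (Const 0)) Skip (Seq (Clear 1) (Seq (transform_prog k) p)))"

lemma runs_CondTrue:
  "test_val (fst s) e \<Longrightarrow> runs B p s a s' \<Longrightarrow> runs B (Cond e p q) s (1 + a) s'"
  unfolding runs_iff_exec by (meson add_mono exec.CondTrue le_refl)

lemma runs_CondFalse:
  "\<not> test_val (fst s) e \<Longrightarrow> runs B q s a s' \<Longrightarrow> runs B (Cond e p q) s (1 + a) s'"
  unfolding runs_iff_exec by (meson add_mono exec.CondFalse le_refl)

text \<open>The time of \<open>transform_prog\<close> with \<open>base\<close> and the bound of
  \<open>length_result\<close> inserted. The final 100 also absorbs the preceding test for the
  degenerate case.\<close>

definition overhead :: "nat \<Rightarrow> nat \<Rightarrow> nat \<Rightarrow> nat \<Rightarrow> nat" where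
  "overhead k n g b =
    k * (n * g * (2 ^ b * (20 * 2 ^ (k * b) + 30) + 30) + 40) +
    10 * (k * (n * g * (2 ^ b * (2 ^ (k * b) + 1) + 1)) + 3) +
    5 * ((2 ^ b + 1) * (n * g) * k + 2 ^ (k * b) + 3) + 100"

text \<open>The summands dominate the parameters, \<open>base\<close>, the output length, block
  words and flagged words. \<open>k ^ 3 * 2 ^ b\<close> stands in for \<open>k ^ 3 * b\<close>
  because polynomial growth will be known for powers of \<open>2 ^ b\<close>.\<close>

definition word_bound :: "nat \<Rightarrow> nat \<Rightarrow> nat \<Rightarrow> nat \<Rightarrow> nat" where
  "word_bound k n g b =
    n + g + k ^ 3 * 2 ^ b + k + ((2 ^ b + 1) * (n * g) * k + 2 ^ (k * b) + 3) +
    (k * (n * g * (2 ^ b * (2 ^ (k * b) + 1) + 1)) + 3) +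
    2 ^ (k * b) * (2 * 2 ^ (k * k * b)) + 2 ^ b + 2 ^ (k * k * b) * 2 ^ k + 10"

context listing
begin

lemma factor_le:
  assumes "j < k"
  shows "factor j \<le> 2 * 2 ^ (k * k * b)"
proof -
  have "b * c * k \<le> k * k * b" if "c < k" for c
    using that by (simp add: mult.commute mult.left_commute)
  moreover have "Suc j mod k < k" using assms by simp
  ultimately have "(2::nat) ^ (b * j * k) \<le> 2 ^ (k * k * b)" "(2::nat) ^ (b * (Suc j mod k) * k) \<le> 2 ^ (k * k * b)"
    using assms by (auto intro!: power_increasing simp del: power_increasing_iff)
  then show ?thesis unfolding factor_def by linarith
qed

lemma flag_le:
  assumes "j < k"
  shows "flag j \<le> 2 ^ (k * k * b) * 2 ^ k"
  using assms by (simp add: flag_def mult.commute[of b] flip: power_add)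

lemma length_result_bound: "base + length result + 7 \<le> word_bound k n g b"
  using length_result unfolding base_def word_bound_def by linarith

lemma word_bounds:
  assumes "word_bound k n g b < B"
  shows "n < B" "g < B" "k ^ 3 * b < B" "base + length result < B" "k < B" "2 ^ b < B"
    "b + 3 < B" "\<And>j. j < k \<Longrightarrow> 2 ^ (k * b) * factor j < B" "\<And>j. j < k \<Longrightarrow> 2 ^ b + flag j < B"
proof -
  have "k ^ 3 * b \<le> k ^ 3 * 2 ^ b" by (simp add: less_imp_le[OF less_exp])
  then show "k ^ 3 * b < B" using assms unfolding word_bound_def by linarith
  show "n < B" "g < B" "k < B" "2 ^ b < B" using assms unfolding word_bound_def by linarith+
  show "base + length result < B" using length_result_bound assms by linarith
  have "b < 2 ^ b" by (rule less_exp)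
  then show "b + 3 < B" using assms unfolding word_bound_def by linarith
  fix j assume j: "j < k"
  have "2 ^ (k * b) * factor j \<le> 2 ^ (k * b) * (2 * 2 ^ (k * k * b))"
    using factor_le[OF j] by (rule mult_le_mono2)
  then show "2 ^ (k * b) * factor j < B" using assms unfolding word_bound_def by linarith
  show "2 ^ b + flag j < B" using flag_le[OF j] assms unfolding word_bound_def by linarith
qed

lemma inp_elem:
  assumes "x \<in> set inp"
  shows "x < word_bound k n g b"
proof -
  have "x \<in> {n, g, b} \<or> x \<le> 1 \<or> x \<le> 2 ^ b"
  proof -
    consider "x \<in> {n, g, b}" | "x \<in> set (truth_table k b f)" |
        Ss S where "Ss \<in> set encoded_sets" "S \<in> set Ss" "x \<in> set (with_length S)"
      using assms unfolding inp_def by auto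
    then show ?thesis
    proof cases
      case 2
      then show ?thesis by (auto simp: truth_table_def)
    next
      case 3
      then show ?thesis using length_set elem_less[OF 3(1,2), of x]
        by (auto simp: with_length_def)
    qed simp
  qed
  moreover have "n < word_bound k n g b" "g < word_bound k n g b" "b < word_bound k n g b"
      "2 ^ b < word_bound k n g b" "1 < word_bound k n g b"
    using less_exp[of b] unfolding word_bound_def by linarith+
  ultimately show ?thesis by auto
qed

lemma reduction_prog_correct:
  assumes "word_bound k n g b < B"
    and p: "\<And>L'. L' \<in> listings k n g (k ^ 3 * b) \<Longrightarrow>
      \<exists>t s. exec B p (initial_state ([n, g, k ^ 3 * b] @ encode_listing L')) t s \<and> real t \<le> T \<and>
        outputs s (factored_count g (xor_zero (k ^ 3 * b)) (listed_sets L'))"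
  shows "\<exists>t s. exec B (reduction_prog k p) (initial_state inp) t s \<and>
    real t \<le> T + real (overhead k n g b) \<and> outputs s (factored_count g f (listed_sets L))"
proof -
  note bounds = word_bounds[OF assms(1)]
  let ?x = "(1 - g) + b + truth_table k b f ! 0"
  let ?M = "\<lambda>i. if i < length inp then inp ! i else 0"
  have t0: "truth_table k b f ! 0 = of_bool (f (decode_tuple k b 0))" by (simp add: truth_table_nth)
  have len: "length inp \<ge> 4"
    unfolding inp_def by (simp add: length_tab Suc_le_eq)
  have M: "inp ! Suc 0 = g" "inp ! 2 = b" "inp ! 3 = truth_table k b f ! 0"
    unfolding inp_def by (simp_all add: nth_append length_tab)
  define s1 :: state where "s1 = ((\<lambda>_. 0)(1 := ?x), ?M)"
  have "?x < B" "3 < B" "1 - g < B" "1 - g + b < B" "2 < B" "1 < B" "0 < B" using bounds(7) by (auto simp: t0)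
  then have check: "runs B (block [Load 1 (Const 1), Op 1 Sub (Const 1) (Reg 1), Load 2 (Const 2),
       Op 1 Add (Reg 1) (Reg 2), Load 2 (Const 3), Op 1 Add (Reg 1) (Reg 2), Clear 2])
     (initial_state inp) 8 s1"
    using M len by (simp add: runs_def initial_state_def s1_def fun_eq_iff)
  have test: "test_val (fst s1) (Eq (Reg 1) (Const 0)) \<longleftrightarrow> ?x = 0" by (simp add: s1_def)
  show ?thesis
  proof (cases "?x = 0")
    case True
    then have *: "b = 0" "g \<noteq> 0" "\<not> f (decode_tuple k b 0)" by (auto simp: t0)
    have "runs B (Cond (Eq (Reg 1) (Const 0)) Skip (Seq (Clear 1) (Seq (transform_prog k) p))) s1 (1 + 1) s1"
      by (rule runs_CondTrue) (use True test in \<open>simp_all only:, simp add: runs_def\<close>)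
    from runs_Seq[OF check this, folded reduction_prog_def]
    obtain t where t: "t \<le> 10" "exec B (reduction_prog k p) (initial_state inp) t s1"
      by (auto simp: runs_iff_exec)
    \<comment> \<open>The solver is not run in this branch, so \<open>0 \<le> T\<close> must be
      obtained separately. As \<open>b = 0\<close>, \<open>L\<close> is itself an XOR instance, and
      the running time on it is a lower bound for \<open>T\<close>.\<close>
    have "L \<in> listings k n g (k ^ 3 * b)" using L *(1) by simp
    from p[OF this] obtain t' where "real t' \<le> T" by blast
    then have "0 \<le> T" by (meson of_nat_0_le_iff order_trans)
    moreover have "t \<le> overhead k n g b" using t(1) unfolding overhead_def by linarith
    then have "real t \<le> real (overhead k n g b)" by (rule of_nat_mono)
    moreover have "outputs s1 (factored_count g f (listed_sets L))"
      using factored_count_zero[OF *] by (simp add: outputs_def s1_def)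
    ultimately show ?thesis using t(2) by fastforce
  next
    case False
    then have "b \<noteq> 0 \<or> g = 0 \<or> f (decode_tuple k b 0)" by (auto simp: t0 split: if_splits)
    note red = new_listing_correct[OF this]
    obtain t s where t: "exec B p (initial_state result) t s" "real t \<le> T"
        "outputs s (factored_count g f (listed_sets L))"
      using p[OF red[THEN conjunct1]] red unfolding encode_listing_output by auto
    have 1: "runs B (Clear 1) s1 1 (initial_state inp)"
      using \<open>0 < B\<close> by (simp add: runs_def s1_def initial_state_def fun_eq_iff)
    have 2: "runs B p (initial_state result) t s" using t(1) by (auto simp: runs_iff_exec)
    note 3 = runs_Seq[OF 1 runs_Seq[OF transform_prog_correct 2]]
    have "runs B (Cond (Eq (Reg 1) (Const 0)) Skip (Seq (Clear 1) (Seq (transform_prog k) p))) s1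
      (1 + (1 + ((k * (n * g * (2 ^ b * (20 * 2 ^ (k * b) + 30) + 30) + 40) + 10 * length result +
        5 * base + 80) + t))) s"
      by (rule runs_CondFalse[OF _ 3[OF bounds(1-5,8,9)]]) (use False test in \<open>simp only:, simp\<close>)
    from runs_Seq[OF check this, folded reduction_prog_def]
    obtain t' where t': "t' \<le> 8 + (1 + (1 + ((k * (n * g * (2 ^ b * (20 * 2 ^ (k * b) + 30) + 30) + 40) +
        10 * length result + 5 * base + 80) + t)))" "exec B (reduction_prog k p) (initial_state inp) t' s"
      by (auto simp: runs_iff_exec)
    \<comment> \<open>The nonlinear terms are replaced by variables, which leaves a linear
      inequality.\<close>
    have "t' \<le> t + (u + 10 * m + 5 * v + 100)"
      if "t' \<le> 8 + (1 + (1 + ((u + 10 * l + 5 * v + 80) + t)))" "l \<le> m" for u v l m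
      using that by linarith
    from this[OF t'(1) length_result] have "t' \<le> t + overhead k n g b"
      unfolding overhead_def base_def .
    then have "real t' \<le> T + real (overhead k n g b)" using t(2) by linarith
    then show ?thesis using t'(2) t(3) by blast
  qed
qed

end

section \<open>Polynomial bounds on machine words\<close>

definition poly_bounded :: "(nat \<Rightarrow> nat) \<Rightarrow> bool" where
  "poly_bounded h \<longleftrightarrow> (\<exists>c. \<forall>n. h n \<le> (n + 2) ^ c)"

lemma poly_bounded_id: "poly_bounded (\<lambda>n. n)"
  unfolding poly_bounded_def by (rule exI[of _ 1]) simp

text \<open>The base \<open>n + 2\<close> is at least 2 even for \<open>n = 0\<close>, so
  \<open>c \<le> 2 ^ c\<close> is enough.\<close>

lemma poly_bounded_const: "poly_bounded (\<lambda>_. c)"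
  unfolding poly_bounded_def
proof (intro exI allI)
  fix n
  have "c \<le> 2 ^ c" by (rule less_imp_le[OF less_exp])
  also have "(2::nat) ^ c \<le> (n + 2) ^ c" by (rule power_mono) auto
  finally show "c \<le> (n + 2) ^ c" .
qed

lemma poly_bounded_mult:
  assumes "poly_bounded f" "poly_bounded g"
  shows "poly_bounded (\<lambda>n. f n * g n)"
proof -
  obtain c d where "\<And>n. f n \<le> (n + 2) ^ c" "\<And>n. g n \<le> (n + 2) ^ d"
    using assms unfolding poly_bounded_def by blast
  then have "f n * g n \<le> (n + 2) ^ (c + d)" for n
    unfolding power_add by (rule mult_le_mono)
  then show ?thesis unfolding poly_bounded_def by blast
qed

lemma poly_bounded_add:
  assumes "poly_bounded f" "poly_bounded g"
  shows "poly_bounded (\<lambda>n. f n + g n)"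
proof -
  obtain c d where cd: "\<And>n. f n \<le> (n + 2) ^ c" "\<And>n. g n \<le> (n + 2) ^ d"
    using assms unfolding poly_bounded_def by blast
  have "f n + g n \<le> (n + 2) ^ (max c d + 1)" for n
  proof -
    have "(n + 2) ^ c \<le> (n + 2) ^ max c d" "(n + 2) ^ d \<le> (n + 2) ^ max c d"
      by (auto intro!: power_increasing simp del: power_increasing_iff)
    then have "f n + g n \<le> 2 * (n + 2) ^ max c d" using cd[of n] by linarith
    also have "\<dots> \<le> (n + 2) * (n + 2) ^ max c d" by (rule mult_le_mono1) simp
    finally show ?thesis by simp
  qed
  then show ?thesis unfolding poly_bounded_def by blast
qed

lemma poly_bounded_power: "poly_bounded f \<Longrightarrow> poly_bounded (\<lambda>n. f n ^ m)"
  by (induction m) (simp_all add: poly_bounded_const[of 1, simplified] poly_bounded_mult)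

text \<open>The finitely many exceptional values are dominated by their sum, a constant.\<close>

lemma poly_bounded_eventually:
  assumes "\<forall>\<^sub>F n in sequentially. h n \<le> n"
  shows "poly_bounded h"
proof -
  obtain N where N: "\<And>n. n \<ge> N \<Longrightarrow> h n \<le> n" using assms by (auto simp: eventually_sequentially)
  have "h n \<le> n + (\<Sum>i<N. h i)" for n
    using N[of n] member_le_sum[of n "{..<N}" h] by (cases "n < N") auto
  moreover have "poly_bounded (\<lambda>n. n + (\<Sum>i<N. h i))"
    by (intro poly_bounded_add poly_bounded_id poly_bounded_const)
  ultimately show ?thesis unfolding poly_bounded_def by (meson order_trans)
qed

text \<open>Each summand is at most a multiple of the right-hand product. The factor
  \<open>g + 1\<close> and the assumption on \<open>n\<close> absorb the table length and the
  constants, which persist when \<open>g = 0\<close>. The numbers 160 and 150 are the sums of the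
  coefficients with and without the factor \<open>k\<close>.\<close>

lemma overhead_le:
  assumes "n \<ge> 1"
  shows "overhead k n g b \<le> (160 * k + 150) * (n * ((g + 1) * 2 ^ (Suc k * b)))"
proof -
  define q K where "q = (2::nat) ^ b" and "K = (2::nat) ^ (k * b)"
  define Z where "Z = n * ((g + 1) * (q * K))"
  have pow: "(2::nat) ^ (Suc k * b) = q * K" by (simp add: q_def K_def power_add)
  have pos: "q \<ge> 1" "K \<ge> 1" by (simp_all add: q_def K_def)
  have "n * g * (q * K) \<le> Z" by (simp add: Z_def algebra_simps)
  moreover have "n * g * q \<le> n * g * (q * K)" "n * g \<le> n * g * q" using pos by simp_all
  ultimately have Z1: "n * g * (q * K) \<le> Z" "n * g * q \<le> Z" "n * g \<le> Z" by linarith+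
  have "1 * K \<le> (n * (g + 1) * q) * K" using pos assms by (intro mult_le_mono1) simp
  then have Z2: "K \<le> Z" by (simp only: Z_def mult.assoc mult_1)
  have Z3: "1 \<le> Z" using Z2 pos by linarith
  have "overhead k n g b = 20 * (k * (n * g * (q * K))) + 30 * (k * (n * g * q)) + 30 * (k * (n * g)) + 40 * k +
     10 * (k * (n * g * (q * K)) + k * (n * g * q) + k * (n * g)) + 30 +
     5 * (k * (n * g * q) + k * (n * g)) + 5 * K + 115"
    unfolding overhead_def q_def[symmetric] K_def[symmetric] by (simp add: algebra_simps)
  also have "\<dots> \<le> 20 * (k * Z) + 30 * (k * Z) + 30 * (k * Z) + 40 * (k * Z) +
     10 * (k * Z + k * Z + k * Z) + 30 * Z + 5 * (k * Z + k * Z) + 5 * Z + 115 * Z"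
    using Z1 Z2 Z3 by (intro add_mono mult_le_mono) simp_all
  also have "\<dots> = (160 * k + 150) * Z" by (simp add: algebra_simps)
  finally show ?thesis unfolding Z_def pow .
qed

section \<open>Comparison of the parameters with small powers of \<open>n\<close>\<close>

lemma eventually_exp_le_powr:
  assumes "(\<lambda>n. real (b n)) \<in> o(\<lambda>n. log 2 (real n))" and "e > 0"
  shows "\<forall>\<^sub>F n in sequentially. 2 ^ (m * b n) \<le> real n powr e"
proof -
  \<comment> \<open>Dividing by \<open>m + 1\<close> keeps the constant positive for
    \<open>m = 0\<close> as well.\<close>
  have "e / (real m + 1) > 0" using assms(2) by simp
  from landau_o.smallD[OF assms(1) this] eventually_ge_at_top[of 1]
  show ?thesis
  proof eventually_elim
    case (elim n)
    have log: "log 2 (real n) \<ge> 0" using elim by simp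
    have "real m * real (b n) \<le> (real m + 1) * (e / (real m + 1) * log 2 (real n))"
      using elim log by (intro mult_mono) auto
    also have "\<dots> = e * log 2 (real n)" by simp
    finally have "2 powr (real m * real (b n)) \<le> 2 powr (e * log 2 (real n))" by simp
    also have "\<dots> = real n powr e"
      using elim by (simp add: powr_powr[symmetric] mult.commute[of e])
    finally show ?case by (simp add: powr_realpow[symmetric])
  qed
qed

text \<open>From \<open>n = 4\<close> on the iterated logarithm in the denominator is at least
  1.\<close>

lemma eventually_le_log:
  assumes "(\<lambda>n. real (g n)) \<in> o(\<lambda>n. log 2 (real n) / log 2 (log 2 (real n)))"
  shows "\<forall>\<^sub>F n in sequentially. real (g n) \<le> log 2 (real n)"
  using landau_o.smallD[OF assms zero_less_one] eventually_ge_at_top[of 4]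
proof eventually_elim
  case (elim n)
  have "log 2 4 \<le> log 2 (real n)" using elim by simp
  moreover have "log 2 (4::real) = 2" using log_pow_cancel[of 2 2] by simp
  ultimately have log: "log 2 (real n) \<ge> 2" by simp
  then have "log 2 2 \<le> log 2 (log 2 (real n))" by (subst log_le_cancel_iff) auto
  then have loglog: "log 2 (log 2 (real n)) \<ge> 1" by simp
  have "real (g n) \<le> \<bar>log 2 (real n)\<bar> / \<bar>log 2 (log 2 (real n))\<bar>" using elim by simp
  also have "\<dots> = log 2 (real n) / log 2 (log 2 (real n))" using log loglog by simp
  also have "\<dots> \<le> log 2 (real n) / 1" using log loglog by (intro divide_left_mono) auto
  finally show ?case by simp
qed

text \<open>The constant comes from \<open>ln x \<le> x powr e / e\<close>, converted to base 2, and
  from \<open>1 \<le> x powr e\<close> for the summand 1.\<close>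

lemma log_bigo_powr:
  assumes "e > 0"
  shows "(\<lambda>n. log 2 (real n) + 1) \<in> O(\<lambda>n. real n powr e)"
proof (rule bigoI)
  show "\<forall>\<^sub>F n in sequentially. norm (log 2 (real n) + 1) \<le> (1 / (e * ln 2) + 1) * norm (real n powr e)"
    using eventually_ge_at_top[of 1]
  proof eventually_elim
    case (elim n)
    have "ln (real n) \<le> real n powr e / e" using elim assms by (intro ln_powr_bound) auto
    then have "log 2 (real n) \<le> (real n powr e / e) / ln 2"
      unfolding log_def by (intro divide_right_mono) auto
    moreover have "1 \<le> real n powr e" using elim assms by (intro ge_one_powr_ge_zero) auto
    moreover have "0 \<le> log 2 (real n)" using elim by simp
    ultimately show ?case by (simp add: algebra_simps)
  qed
qed

theorem theorem1p7:
  fixes k :: nat and g b :: "nat \<Rightarrow> nat" and T :: "nat \<Rightarrow> real"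
  assumes "k \<ge> 2"
    and "(\<lambda>n. real (g n)) \<in> o(\<lambda>n. log 2 (real n) / log 2 (log 2 (real n)))"
    and "(\<lambda>n. real (b n)) \<in> o(\<lambda>n. log 2 (real n))"
    and "solvable_in_time (FkXOR k g (\<lambda>n. k ^ 3 * b n)) T"
  shows "\<forall>f :: nat \<Rightarrow> bool list list \<Rightarrow> bool.
           \<exists>r \<in> soft_O (\<lambda>n. real n). solvable_in_time (Fkf k g b f) (\<lambda>n. T n + r n)"
proof
  fix f :: "nat \<Rightarrow> bool list list \<Rightarrow> bool"
  \<comment> \<open>The overhead involves \<open>f\<close> only through the length of its table, so
    the same \<open>r\<close> serves every \<open>f\<close>.\<close>
  define r where "r n = real (overhead k n (g n) (b n))" for n
  obtain p c where p: "\<And>n inp ans. (inp, ans) \<in> FkXOR k g (\<lambda>n. k ^ 3 * b n) n \<Longrightarrow>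
      \<exists>t s. exec ((n + 2) ^ c) p (initial_state inp) t s \<and> real t \<le> T n \<and> outputs s ans"
    using assms(4) unfolding solvable_in_time_def solves_in_time_def by fast

  have r: "r \<in> soft_O (\<lambda>n. real n)"
    unfolding soft_O_def
  proof (intro CollectI exI conjI allI impI)
    \<comment> \<open>What \<open>overhead_le\<close> leaves beside \<open>n\<close> is the
      subpolynomial factor; each of its two parts is allowed growth
      \<open>n powr (e / 2)\<close>.\<close>
    let ?s = "\<lambda>n. (real (g n) + 1) * 2 ^ (Suc k * b n)"
    fix e :: real assume e: "e > 0"
    have "(\<lambda>n. real (g n) + 1) \<in> O(\<lambda>n. log 2 (real n) + 1)"
      using eventually_le_log[OF assms(2)] by (intro bigoI[of _ 1]) (auto elim: eventually_mono)
    also have "(\<lambda>n. log 2 (real n) + 1) \<in> O(\<lambda>n. real n powr (e / 2))"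
      using e by (intro log_bigo_powr) simp
    finally have "(\<lambda>n. real (g n) + 1) \<in> O(\<lambda>n. real n powr (e / 2))" .
    moreover have "(\<lambda>n. 2 ^ (Suc k * b n)) \<in> O(\<lambda>n. real n powr (e / 2))"
      using eventually_exp_le_powr[OF assms(3), of "e / 2" "Suc k"] e by (intro bigoI[of _ 1]) simp
    ultimately have "?s \<in> O(\<lambda>n. real n powr (e / 2) * real n powr (e / 2))"
      by (rule landau_o.big.mult)
    then show "?s \<in> O(\<lambda>n. real n powr e)" by (simp flip: powr_add)
  next
    show "r \<in> O(\<lambda>n. real n * ((real (g n) + 1) * 2 ^ (Suc k * b n)))"
    proof (rule bigoI[of _ "real (160 * k + 150)"])
      show "\<forall>\<^sub>F n in sequentially. norm (r n) \<le>
          real (160 * k + 150) * norm (real n * ((real (g n) + 1) * 2 ^ (Suc k * b n)))"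
        using eventually_ge_at_top[of 1]
      proof eventually_elim
        case (elim n)
        have "r n \<le> real ((160 * k + 150) * (n * ((g n + 1) * 2 ^ (Suc k * b n))))"
          unfolding r_def using overhead_le[OF elim] by (rule of_nat_mono)
        also have "\<dots> = real (160 * k + 150) * (real n * ((real (g n) + 1) * 2 ^ (Suc k * b n)))"
          by (simp only: of_nat_mult of_nat_add of_nat_power of_nat_1 of_nat_numeral)
        finally show ?case by (simp add: r_def)
      qed
    qed
  qed

  have "poly_bounded (\<lambda>n. 2 ^ b n)"
  proof (rule poly_bounded_eventually)
    show "\<forall>\<^sub>F n in sequentially. 2 ^ b n \<le> n"
      using eventually_exp_le_powr[OF assms(3) zero_less_one, of 1]
    proof eventually_elim
      case (elim n)
      then have "real (2 ^ b n) \<le> real n" by simp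
      then show ?case by (simp only: of_nat_le_iff)
    qed
  qed
  then have q: "poly_bounded (\<lambda>n. 2 ^ (m * b n))" for m
    using poly_bounded_power[of "\<lambda>n. 2 ^ b n" m] by (simp add: mult.commute flip: power_mult)
  have gb: "poly_bounded g"
  proof (rule poly_bounded_eventually)
    show "\<forall>\<^sub>F n in sequentially. g n \<le> n"
      using eventually_le_log[OF assms(2)] eventually_ge_at_top[of 1]
    proof eventually_elim
      case (elim n)
      have "real n < 2 ^ n" by (rule of_nat_less_two_power)
      then have "log 2 (real n) \<le> log 2 (2 ^ n)" using elim by (subst log_le_cancel_iff) auto
      then have "log 2 (real n) \<le> real n" by simp
      then show ?case using elim by linarith
    qed
  qed
  have "poly_bounded (\<lambda>n. word_bound k n (g n) (b n))"
    unfolding word_bound_def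
    by (intro poly_bounded_add poly_bounded_mult poly_bounded_const poly_bounded_id gb q q[of 1, simplified])
  then obtain d where d: "\<And>n. word_bound k n (g n) (b n) \<le> (n + 2) ^ d"
    unfolding poly_bounded_def by blast
  \<comment> \<open>\<open>Suc d\<close> makes the bound on the words strict, and the maximum leaves
    enough room for the solver.\<close>
  define C where "C = max c (Suc d)"
  have C: "(n + 2) ^ c \<le> (n + 2) ^ C" "word_bound k n (g n) (b n) < (n + 2) ^ C" for n
  proof -
    show "(n + 2) ^ c \<le> (n + 2) ^ C" by (rule power_increasing) (auto simp: C_def)
    have "(n + 2) ^ d < (n + 2) ^ C" by (rule power_strict_increasing) (auto simp: C_def)
    then show "word_bound k n (g n) (b n) < (n + 2) ^ C" using d[of n] by linarith
  qed

  have "solves_in_time (reduction_prog k p) (Fkf k g b f) (\<lambda>n. T n + r n)"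
    unfolding solves_in_time_def
  proof (intro exI[of _ C] allI ballI)
    fix n io assume "io \<in> Fkf k g b f n"
    then obtain L where io: "L \<in> listings k n (g n) (b n)"
      "io = ([n, g n, b n] @ truth_table k (b n) (f n) @ encode_listing L,
         factored_count (g n) (f n) (listed_sets L))"
      unfolding Fkf_def by blast
    interpret listing k n "g n" "b n" "f n" L
      by unfold_locales (use assms(1) io(1) in auto)
    have "length inp \<le> (n + 2) ^ C"
      using length_inp length_result_bound C(2)[of n] by linarith
    moreover have "x < (n + 2) ^ C" if "x \<in> set inp" for x
      using inp_elem[OF that] C(2)[of n] by linarith
    moreover have "\<exists>t s. exec ((n + 2) ^ C) (reduction_prog k p) (initial_state inp) t s \<and>
        real t \<le> T n + r n \<and> outputs s (factored_count (g n) (f n) (listed_sets L))"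
      unfolding r_def
    proof (rule reduction_prog_correct[OF C(2)])
      fix L' assume "L' \<in> listings k n (g n) (k ^ 3 * b n)"
      then have "([n, g n, k ^ 3 * b n] @ encode_listing L',
          factored_count (g n) (xor_zero (k ^ 3 * b n)) (listed_sets L')) \<in> FkXOR k g (\<lambda>n. k ^ 3 * b n) n"
        unfolding FkXOR_def by blast
      from p[OF this] show "\<exists>t s. exec ((n + 2) ^ C) p
          (initial_state ([n, g n, k ^ 3 * b n] @ encode_listing L')) t s \<and> real t \<le> T n \<and>
          outputs s (factored_count (g n) (xor_zero (k ^ 3 * b n)) (listed_sets L'))"
        using exec_mono[OF _ C(1)] by blast
    qed
    ultimately show "case io of (xs, ans) \<Rightarrow>
        length xs \<le> (n + 2) ^ C \<and> (\<forall>x\<in>set xs. x < (n + 2) ^ C) \<and>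
        (\<exists>t s. exec ((n + 2) ^ C) (reduction_prog k p) (initial_state xs) t s \<and>
           real t \<le> T n + r n \<and> outputs s ans)"
      unfolding io(2) encode_listing_input by blast
  qed
  then show "\<exists>r \<in> soft_O (\<lambda>n. real n). solvable_in_time (Fkf k g b f) (\<lambda>n. T n + r n)"
    using r unfolding solvable_in_time_def by blast
qed

end
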